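(* Let $(q^*,\bar e^*,\bar f^*,\bar a^* )$ be an optimal solution of the fluid-based optimization problem (defined in the context). (a) Suppose that $(\bar E^{(N)},\bar F^{(N)})$ has a single recurrent class under $P$ and $Q$, where $Q$ may be a state-dependent routing policy. Then $$\sum_{i=1}^r\sum_{j=1}^r A_i^{(N)}(\infty)\lambda_iP_{ij}c_{ij}<\sum_{i=1}^r\sum_{j=1}^r\bar a_i^*\lambda_iP_{ij}c_{ij},\qquad N>0.$$ (b) Let $A_i^{(N)*}(\infty)$ denote the availability $A^{(N)}_i(\infty)$ of the chain under the static routing policy $Q=q^*$. If $P_{ij}>0$ for all $1\le i,j\le r$ and $q^*_{ii}>0$ for all $1\le i\le r$, then $$\lim_{N\to\infty}\sum_{i=1}^r\sum_{j=1}^r A_i^{(N)*}(\infty)\lambda_iP_{ij}c_{ij}=\sum_{i=1}^r\sum_{j=1}^r\bar a_i^*\lambda_iP_{ij}c_{ij}.$$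
   Context: Fix an integer $r\ge1$ (number of regions), reals $\lambda_i>0$, $\mu_{ij}>0$, $c_{ij}>0$ ($1\le i,j\le r$), and an $r\times r$ row-stochastic matrix $P=(P_{ij})$. Let $$\mathcal{T}=\Big\{(e,f)\in[0,1]^{r\times r}\times[0,1]^{r\times r}:\ \sum_{i=1}^r\sum_{j=1}^r(e_{ij}+f_{ij})=1\Big\}.$$ A (state-dependent) routing policy is a function $Q$ assigning to each $(e,f)\in\mathcal{T}$ an $r\times r$ row-stochastic matrix $Q(e,f)=(Q_{ij}(e,f))$; it is static if it is constant. For each positive integer $N$ (number of cars), $(E^{(N)},F^{(N)})$ is the continuous-time Markov chain on the finite set of pairs $(E,F)\in\mathbb{Z}_+^{r\times r}\times\mathbb{Z}_+^{r\times r}$ with $\sum_{i,j}(E_{ij}+F_{ij})=N$ and the following transitions: (i) for all $i,j$: at rate $N\lambda_iP_{ij}1(E_{ii}>0)$, $E_{ii}$ decreases by 1 and $F_{ij}$ increases by 1; (ii) for all $i,j,k$: at rate $\mu_{ij}F_{ij}Q_{jk}(E/N,F/N)$, $F_{ij}$ decreases by 1 and $E_{jk}$ increases by 1; (iii) for all $i\ne j$: at rate $\mu_{ij}E_{ij}$, $E_{ij}$ decreases by 1 and $E_{jj}$ increases by 1. Set $\bar E^{(N)}=E^{(N)}/N$, $\bar F^{(N)}=F^{(N)}/N$. When the chain has a single recurrent class, $(\bar E^{(N)}(\infty),\bar F^{(N)}(\infty))$ denotes a random element with its stationary distribution, and $A_i^{(N)}(\infty)=\mathbb{P}(\bar E^{(N)}_{ii}(\infty)>0)$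 is the availability at region $i$. The fluid-based optimization problem is: maximize $\sum_{i=1}^r\sum_{j=1}^r\bar a_i\lambda_iP_{ij}c_{ij}$ over $(q,\bar e,\bar f,\bar a)$, with $q,\bar e,\bar f$ real $r\times r$ matrices and $\bar a\in\mathbb{R}^r$, subject to $\lambda_iP_{ij}\bar a_i=\mu_{ij}\bar f_{ij}$ for $1\le i,j\le r$; $\mu_{ij}\bar e_{ij}=q_{ij}\sum_{k=1}^r\mu_{ki}\bar f_{ki}$ for $1\le i\neq j\le r$; $\lambda_i\bar a_i=\sum_{k\ne i}\mu_{ki}\bar e_{ki}+q_{ii}\sum_{k=1}^r\mu_{ki}\bar f_{ki}$ for $1\le i\le r$; $(1-\bar a_i)\bar e_{ii}=0$ for $1\le i\le r$; $(\bar e,\bar f)\in\mathcal{T}$; $q_{ij}\ge0$, $\sum_{j=1}^rq_{ij}=1$, $0\le\bar a_i\le1$ for $1\le i,j\le r$. *)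

theory Defs
  imports "HOL-Probability.Probability"
begin

section \<open>Finite continuous-time Markov chains given by transition rates\<close>

text \<open>
  A chain on a finite set \<open>S\<close> is given by rates \<open>R x y\<close> of jumping from \<open>x\<close> to \<open>y \<noteq> x\<close>; the diagonal
  of \<open>R\<close> is ignored.  Its transition function is the matrix exponential \<open>exp (t G)\<close> of the
  generator \<open>G\<close>.
\<close>

definition generator :: "'s set \<Rightarrow> ('s \<Rightarrow> 's \<Rightarrow> real) \<Rightarrow> 's \<Rightarrow> 's \<Rightarrow> real" where
  "generator S R x y = (if x = y then - (\<Sum>z\<in>S - {x}. R x z) else R x y)"

primrec mat_pow :: "'s set \<Rightarrow> ('s \<Rightarrow> 's \<Rightarrow> real) \<Rightarrow> nat \<Rightarrow> 's \<Rightarrow> 's \<Rightarrow> real" where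
  "mat_pow S G 0 x y = (if x = y then 1 else 0)"
| "mat_pow S G (Suc n) x y = (\<Sum>z\<in>S. G x z * mat_pow S G n z y)"

definition trans_prob :: "'s set \<Rightarrow> ('s \<Rightarrow> 's \<Rightarrow> real) \<Rightarrow> real \<Rightarrow> 's \<Rightarrow> 's \<Rightarrow> real" where
  "trans_prob S R t x y = (\<Sum>n. t ^ n / fact n * mat_pow S (generator S R) n x y)"

definition is_stationary :: "'s set \<Rightarrow> ('s \<Rightarrow> 's \<Rightarrow> real) \<Rightarrow> 's pmf \<Rightarrow> bool" where
  "is_stationary S R \<pi> \<longleftrightarrow> set_pmf \<pi> \<subseteq> S \<and>
     (\<forall>t\<ge>0. \<forall>y\<in>S. (\<Sum>x\<in>S. pmf \<pi> x * trans_prob S R t x y) = pmf \<pi> y)"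

text \<open>Meaningful when there is exactly one stationary distribution.\<close>

definition stationary_dist :: "'s set \<Rightarrow> ('s \<Rightarrow> 's \<Rightarrow> real) \<Rightarrow> 's pmf" where
  "stationary_dist S R = (THE \<pi>. is_stationary S R \<pi>)"

definition accessible :: "'s set \<Rightarrow> ('s \<Rightarrow> 's \<Rightarrow> real) \<Rightarrow> 's \<Rightarrow> 's \<Rightarrow> bool" where
  "accessible S R = (\<lambda>x y. x \<in> S \<and> y \<in> S \<and> R x y > 0)\<^sup>*\<^sup>*"

text \<open>As the chain is finite, a state is recurrent iff it can be reached back from every
  state accessible from it.\<close>

definition recurrent_state :: "'s set \<Rightarrow> ('s \<Rightarrow> 's \<Rightarrow> real) \<Rightarrow> 's \<Rightarrow> bool" where
  "recurrent_state S R x \<longleftrightarrow> x \<in> S \<and> (\<forall>y. accessible S R x y \<longrightarrow> accessible S R y x)"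

definition recurrent_classes :: "'s set \<Rightarrow> ('s \<Rightarrow> 's \<Rightarrow> real) \<Rightarrow> 's set set" where
  "recurrent_classes S R =
     {{y. accessible S R x y \<and> accessible S R y x} | x. recurrent_state S R x}"

definition single_recurrent_class :: "'s set \<Rightarrow> ('s \<Rightarrow> 's \<Rightarrow> real) \<Rightarrow> bool" where
  "single_recurrent_class S R \<longleftrightarrow> (\<exists>!C. C \<in> recurrent_classes S R)"


section \<open>The ridesharing network\<close>

text \<open>The regions are the elements of a finite type \<open>'r\<close>; matrices are functions of two indices.\<close>

type_synonym 'r mat = "'r \<Rightarrow> 'r \<Rightarrow> real"
type_synonym 'r state = "('r \<Rightarrow> 'r \<Rightarrow> nat) \<times> ('r \<Rightarrow> 'r \<Rightarrow> nat)"

definition row_stochastic :: "('r::finite) mat \<Rightarrow> bool" where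
  "row_stochastic M \<longleftrightarrow> (\<forall>i j. 0 \<le> M i j) \<and> (\<forall>i. (\<Sum>j\<in>UNIV. M i j) = 1)"

definition fluid_space :: "(('r::finite) mat \<times> 'r mat) set" where
  "fluid_space = {(e, f). (\<forall>i j. e i j \<in> {0..1} \<and> f i j \<in> {0..1}) \<and>
                          (\<Sum>i\<in>UNIV. \<Sum>j\<in>UNIV. e i j + f i j) = 1}"

definition routing_policy :: "(('r::finite) mat \<times> 'r mat \<Rightarrow> 'r mat) \<Rightarrow> bool" where
  "routing_policy Q \<longleftrightarrow> (\<forall>s\<in>fluid_space. row_stochastic (Q s))"

definition states :: "nat \<Rightarrow> ('r::finite) state set" where
  "states N = {(E, F). (\<Sum>i\<in>UNIV. \<Sum>j\<in>UNIV. E i j + F i j) = N}"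

definition scaled :: "nat \<Rightarrow> ('r \<Rightarrow> 'r \<Rightarrow> nat) \<Rightarrow> 'r mat" where
  "scaled N M = (\<lambda>i j. real (M i j) / real N)"

definition inc :: "('r \<Rightarrow> 'r \<Rightarrow> nat) \<Rightarrow> 'r \<Rightarrow> 'r \<Rightarrow> ('r \<Rightarrow> 'r \<Rightarrow> nat)" where
  "inc M i j = M(i := (M i)(j := M i j + 1))"

definition dec :: "('r \<Rightarrow> 'r \<Rightarrow> nat) \<Rightarrow> 'r \<Rightarrow> 'r \<Rightarrow> ('r \<Rightarrow> 'r \<Rightarrow> nat)" where
  "dec M i j = M(i := (M i)(j := M i j - 1))"

text \<open>
  The three sums are: a customer takes a car at \<open>i\<close> to \<open>j\<close>; a full car from \<open>i\<close> reaches \<open>j\<close> and is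
  routed to \<open>k\<close>; an empty car from \<open>i\<close> reaches \<open>j\<close>.  A transition that would decrement a zero
  entry has rate zero, so the truncated subtraction in \<open>dec\<close> is harmless.
\<close>

definition rate ::
  "(('r::finite) \<Rightarrow> real) \<Rightarrow> 'r mat \<Rightarrow> 'r mat \<Rightarrow> ('r mat \<times> 'r mat \<Rightarrow> 'r mat) \<Rightarrow> nat \<Rightarrow>
   'r state \<Rightarrow> 'r state \<Rightarrow> real" where
  "rate lam mu P Q N = (\<lambda>(E, F) y.
     (\<Sum>i\<in>UNIV. \<Sum>j\<in>UNIV.
        if E i i > 0 \<and> y = (dec E i i, inc F i j) then real N * lam i * P i j else 0)
   + (\<Sum>i\<in>UNIV. \<Sum>j\<in>UNIV. \<Sum>k\<in>UNIV.
        if y = (inc E j k, dec F i j)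
        then mu i j * real (F i j) * Q (scaled N E, scaled N F) j k else 0)
   + (\<Sum>i\<in>UNIV. \<Sum>j\<in>UNIV - {i}.
        if y = (inc (dec E i j) j j, F) then mu i j * real (E i j) else 0))"

definition availability ::
  "(('r::finite) \<Rightarrow> real) \<Rightarrow> 'r mat \<Rightarrow> 'r mat \<Rightarrow> ('r mat \<times> 'r mat \<Rightarrow> 'r mat) \<Rightarrow> nat \<Rightarrow>
   'r \<Rightarrow> real" where
  "availability lam mu P Q N i =
     measure_pmf.prob (stationary_dist (states N) (rate lam mu P Q N))
       {(E, F). scaled N E i i > 0}"


section \<open>The fluid-based optimization problem\<close>

definition reward :: "(('r::finite) \<Rightarrow> real) \<Rightarrow> 'r mat \<Rightarrow> 'r mat \<Rightarrow> ('r \<Rightarrow> real) \<Rightarrow> real" where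
  "reward lam P c a = (\<Sum>i\<in>UNIV. \<Sum>j\<in>UNIV. a i * lam i * P i j * c i j)"

definition fluid_feasible ::
  "(('r::finite) \<Rightarrow> real) \<Rightarrow> 'r mat \<Rightarrow> 'r mat \<Rightarrow>
   'r mat \<Rightarrow> 'r mat \<Rightarrow> 'r mat \<Rightarrow> ('r \<Rightarrow> real) \<Rightarrow> bool" where
  "fluid_feasible lam mu P q e f a \<longleftrightarrow>
     (\<forall>i j. lam i * P i j * a i = mu i j * f i j) \<and>
     (\<forall>i j. i \<noteq> j \<longrightarrow> mu i j * e i j = q i j * (\<Sum>k\<in>UNIV. mu k i * f k i)) \<and>
     (\<forall>i. lam i * a i =
        (\<Sum>k\<in>UNIV - {i}. mu k i * e k i) + q i i * (\<Sum>k\<in>UNIV. mu k i * f k i)) \<and>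
     (\<forall>i. (1 - a i) * e i i = 0) \<and>
     (e, f) \<in> fluid_space \<and>
     row_stochastic q \<and>
     (\<forall>i. 0 \<le> a i \<and> a i \<le> 1)"

definition fluid_optimal ::
  "(('r::finite) \<Rightarrow> real) \<Rightarrow> 'r mat \<Rightarrow> 'r mat \<Rightarrow> 'r mat \<Rightarrow>
   'r mat \<Rightarrow> 'r mat \<Rightarrow> 'r mat \<Rightarrow> ('r \<Rightarrow> real) \<Rightarrow> bool" where
  "fluid_optimal lam mu c P q e f a \<longleftrightarrow>
     fluid_feasible lam mu P q e f a \<and>
     (\<forall>q' e' f' a'. fluid_feasible lam mu P q' e' f' a' \<longrightarrow> reward lam P c a' \<le> reward lam P c a)"


text \<open>Finiteness of the state space matters: sums over infinite sets are zero.\<close>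

lemma finite_states: "finite (states N :: ('r::finite) state set)"
proof -
  let ?B = "PiE (UNIV :: 'r set) (\<lambda>_. PiE (UNIV :: 'r set) (\<lambda>_. {..N}))"
  have "states N \<subseteq> ?B \<times> ?B"
  proof (rule subsetI)
    fix x :: "'r state" assume "x \<in> states N"
    then obtain E F where x: "x = (E, F)"
      and s: "(\<Sum>i\<in>UNIV. \<Sum>j\<in>UNIV. E i j + F i j) = N"
      unfolding states_def by auto
    have "E i j + F i j \<le> N" for i j
    proof -
      have "E i j + F i j \<le> (\<Sum>j\<in>UNIV. E i j + F i j)"
        by (rule member_le_sum) auto
      also have "\<dots> \<le> (\<Sum>i\<in>UNIV. \<Sum>j\<in>UNIV. E i j + F i j)"
        by (rule member_le_sum[where f = "\<lambda>i. \<Sum>j\<in>UNIV. E i j + F i j"]) auto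
      finally show ?thesis using s by simp
    qed
    then show "x \<in> ?B \<times> ?B"
      unfolding x by (auto simp: PiE_UNIV_domain intro: add_leD1 add_leD2)
  qed
  moreover have "finite ?B" by (intro finite_PiE) auto
  ultimately show ?thesis by (meson finite_SigmaI finite_subset)
qed

end

theory Submission
  imports Defs "HOL-Real_Asymp.Real_Asymp"
begin

text \<open>
  Upper bound: the stationary means of the scaled chain satisfy all constraints of the fluid problem
  except possibly complementarity \<open>(1 - a i) * e i i = 0\<close>.  As every availability is below 1 and some
  car is idle with positive probability, all flows can be scaled up by a factor greater than 1, which
  yields a feasible point of larger reward.

  Limit: under a static policy the chain has a product form stationary distribution, and its
  availabilities are \<open>\<alpha> * a i\<close> with \<open>\<alpha> = g (N - 1) / g N\<close> for the normalizing constants \<open>g\<close>.  The upper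
  bound gives \<open>\<alpha> < 1\<close>.  Mean value analysis, that is a recursion for \<open>g\<close> and the expected number of
  idle cars obtained by removing one car, gives \<open>\<alpha> \<ge> N / (N + r + sqrt (r * N))\<close>.
\<close>

section \<open>Stationary distributions of finite chains\<close>

text \<open>Stationarity is defined by matrix exponentials, whereas all computations concern single
  jumps. Comparing power series reduces it to global balance, which is then tested against
  functions: linear ones give the mean flows, arbitrary ones the product form.
  \<open>stationary_dist\<close> is a definite description, so existence and uniqueness of the
  stationary law must both be proved; uniqueness is obtained from a state accessible from
  everywhere. A state-dependent \<open>Q\<close> admits no explicit law, but averaging it by the
  flow through each region gives one stochastic matrix; this is why the fluid bound covers all
  policies. In the limit, the delicate case is that no fluid is idle: g (N - 1) / g N can then
  differ from 1 by a multiple of N^(-1/2). Since the fluid has mass 1, the load of the moving cars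
  is at most N, and the term r + sqrt (r N) is a choice of D with D^2 \<ge> r (N + D), the condition
  under which the induction on the number of cars closes.\<close>

lemma mat_pow_bound:
  assumes "finite S" "x \<in> S"
  shows "\<bar>mat_pow S G n x y\<bar> \<le> (\<Sum>u\<in>S. \<Sum>z\<in>S. \<bar>G u z\<bar>) ^ n"
  using assms(2)
proof (induction n arbitrary: x)
  case (Suc n)
  let ?K = "\<Sum>u\<in>S. \<Sum>z\<in>S. \<bar>G u z\<bar>"
  have "\<bar>mat_pow S G (Suc n) x y\<bar> \<le> (\<Sum>z\<in>S. \<bar>G x z\<bar> * \<bar>mat_pow S G n z y\<bar>)"
    by (simp add: sum_abs flip: abs_mult)
  also have "\<dots> \<le> (\<Sum>z\<in>S. \<bar>G x z\<bar> * ?K ^ n)"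
    by (intro sum_mono mult_left_mono Suc.IH) auto
  also have "\<dots> = (\<Sum>z\<in>S. \<bar>G x z\<bar>) * ?K ^ n"
    by (simp add: sum_distrib_right)
  also have "\<dots> \<le> ?K * ?K ^ n"
    by (intro mult_right_mono zero_le_power sum_nonneg
        member_le_sum[of x S "\<lambda>u. \<Sum>z\<in>S. \<bar>G u z\<bar>"])
      (use Suc.prems assms(1) in \<open>auto intro: sum_nonneg\<close>)
  finally show ?case by simp
qed simp

lemma summable_trans_prob:
  fixes t :: real
  assumes "finite S" "x \<in> S"
  shows "summable (\<lambda>n. t ^ n / fact n * mat_pow S G n x y)"
proof (rule summable_comparison_test')
  let ?K = "\<Sum>u\<in>S. \<Sum>z\<in>S. \<bar>G u z\<bar>"
  show "summable (\<lambda>n. inverse (fact n) * (\<bar>t\<bar> * ?K) ^ n)"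
    by (rule summable_exp)
  show "norm (t ^ n / fact n * mat_pow S G n x y) \<le> inverse (fact n) * (\<bar>t\<bar> * ?K) ^ n" for n
    using mult_left_mono[OF mat_pow_bound[OF assms, of G n y], of "\<bar>t\<bar> ^ n / fact n"]
    by (simp add: abs_mult power_abs power_mult_distrib field_simps)
qed

lemma sums_trans_prob:
  fixes t :: real
  assumes "finite S"
  shows "(\<lambda>n. (\<Sum>x\<in>S. p x * mat_pow S (generator S R) n x y) / fact n * t ^ n) sums
           (\<Sum>x\<in>S. p x * trans_prob S R t x y)"
proof -
  have "(\<lambda>n. \<Sum>x\<in>S. p x * (t ^ n / fact n * mat_pow S (generator S R) n x y)) sums
           (\<Sum>x\<in>S. p x * trans_prob S R t x y)"
    unfolding trans_prob_def
    by (intro sums_sum sums_mult summable_sums summable_trans_prob assms)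
  then show ?thesis
    by (simp add: sum_distrib_left sum_divide_distrib mult_ac)
qed

lemma sum_mat_pow_Suc:
  "(\<Sum>x\<in>S. p x * mat_pow S G (Suc n) x y) = (\<Sum>z\<in>S. (\<Sum>x\<in>S. p x * G x z) * mat_pow S G n z y)"
  by (simp add: sum_distrib_left sum_distrib_right mult.assoc) (rule sum.swap)

text \<open>Constancy is known only for \<open>t \<ge> 0\<close>, but the series converges
  everywhere, so its two-sided derivative \<open>c 1\<close> at 0 can be computed as a right-hand
  limit, where the difference quotient vanishes.\<close>

lemma powser_constant_imp_coeff_1_zero:
  fixes c :: "nat \<Rightarrow> real"
  assumes sums: "\<And>t. (\<lambda>n. c n * t ^ n) sums f t" and const: "\<And>t. t \<ge> 0 \<Longrightarrow> f t = k"
  shows "c 1 = 0"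
proof -
  have f: "f = (\<lambda>t. \<Sum>n. c n * t ^ n)"
    using sums by (auto simp: sums_iff)
  have "(f has_field_derivative (\<Sum>n. diffs c n * 0 ^ n)) (at 0)"
    unfolding f using sums
    by (intro termdiffs_strong_converges_everywhere) (auto simp: sums_iff)
  then have "(f has_field_derivative c 1) (at 0)"
    by (simp add: powser_zero diffs_def)
  then have "((\<lambda>t. (f t - f 0) / (t - 0)) \<longlongrightarrow> c 1) (at_right 0)"
    unfolding has_field_derivative_iff by (simp add: filterlim_at_split)
  moreover have "\<forall>\<^sub>F t in at_right 0. (f t - f 0) / (t - 0) = 0"
    using const by (auto simp: eventually_at_filter)
  ultimately have "((\<lambda>t. 0) \<longlongrightarrow> c 1) (at_right (0::real))"
    by (rule Lim_transform_eventually)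
  then show ?thesis
    by (simp add: tendsto_const_iff)
qed

text \<open>Global balance. The diagonal rate \<open>R y y\<close> occurs on both sides with the
  factor \<open>p y\<close>, so the sums may run over all of \<open>S\<close> although the chain
  ignores the diagonal.\<close>

definition invariant :: "'s set \<Rightarrow> ('s \<Rightarrow> 's \<Rightarrow> real) \<Rightarrow> ('s \<Rightarrow> real) \<Rightarrow> bool" where
  "invariant S R p \<longleftrightarrow> (\<forall>y\<in>S. (\<Sum>x\<in>S. p x * R x y) = p y * (\<Sum>z\<in>S. R y z))"

lemma sum_generator:
  assumes "finite S" "y \<in> S"
  shows "(\<Sum>x\<in>S. p x * generator S R x y) = (\<Sum>x\<in>S. p x * R x y) - p y * (\<Sum>z\<in>S. R y z)"
proof -
  have "(\<Sum>x\<in>S. p x * generator S R x y) =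
      - p y * (\<Sum>z\<in>S - {y}. R y z) + (\<Sum>x\<in>S - {y}. p x * R x y)"
    by (subst sum.remove[OF assms]) (simp add: generator_def)
  then show ?thesis
    using sum.remove[OF assms, of "R y"] sum.remove[OF assms, of "\<lambda>x. p x * R x y"]
    by (simp add: algebra_simps)
qed

text \<open>The coefficients of \<pi> exp (t G) are \<pi> G^n / n!. Constancy in \<open>t\<close>
  kills the one with \<open>n = 1\<close>; conversely \<pi> G = 0 kills all with
  \<open>n \<ge> 1\<close> and leaves \<pi>.\<close>

lemma is_stationary_iff_invariant:
  assumes "finite S"
  shows "is_stationary S R \<pi> \<longleftrightarrow> set_pmf \<pi> \<subseteq> S \<and> invariant S R (pmf \<pi>)"
proof -
  let ?G = "generator S R"
  define b where "b n y = (\<Sum>x\<in>S. pmf \<pi> x * mat_pow S ?G n x y)" for n y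
  have b0: "b 0 y = pmf \<pi> y" if "y \<in> S" for y
    using that assms by (simp add: b_def if_distrib sum.delta cong: if_cong)
  have bSuc: "b (Suc n) y = (\<Sum>z\<in>S. (\<Sum>x\<in>S. pmf \<pi> x * ?G x z) * mat_pow S ?G n z y)" for n y
    unfolding b_def by (rule sum_mat_pow_Suc)
  have b1: "b 1 y = (\<Sum>x\<in>S. pmf \<pi> x * ?G x y)" if "y \<in> S" for y
    using bSuc[of 0 y] that assms by (simp add: if_distrib sum.delta cong: if_cong)
  have sums: "(\<lambda>n. b n y / fact n * t ^ n) sums (\<Sum>x\<in>S. pmf \<pi> x * trans_prob S R t x y)" for t y
    unfolding b_def by (rule sums_trans_prob[OF assms])
  have inv: "invariant S R (pmf \<pi>) \<longleftrightarrow> (\<forall>y\<in>S. (\<Sum>x\<in>S. pmf \<pi> x * ?G x y) = 0)"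
    by (auto simp: invariant_def sum_generator[OF assms])
  have "(\<forall>t\<ge>0. \<forall>y\<in>S. (\<Sum>x\<in>S. pmf \<pi> x * trans_prob S R t x y) = pmf \<pi> y) \<longleftrightarrow>
      invariant S R (pmf \<pi>)"
  proof
    assume *: "\<forall>t\<ge>0. \<forall>y\<in>S. (\<Sum>x\<in>S. pmf \<pi> x * trans_prob S R t x y) = pmf \<pi> y"
    have "b 1 y = 0" if "y \<in> S" for y
      using powser_constant_imp_coeff_1_zero[of "\<lambda>n. b n y / fact n", OF sums] * that by simp
    then show "invariant S R (pmf \<pi>)"
      unfolding inv using b1 by simp
  next
    assume "invariant S R (pmf \<pi>)"
    then have zero: "b (Suc n) y = 0" for n y
      unfolding bSuc inv by simp
    have "(\<lambda>n. b n y / fact n * t ^ n) sums (\<Sum>n\<in>{0}. b n y / fact n * t ^ n)" for t y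
      by (rule sums_finite) (auto simp: zero gr0_conv_Suc)
    then have "(\<Sum>x\<in>S. pmf \<pi> x * trans_prob S R t x y) = b 0 y" for t y
      using sums_unique2[OF sums] by fastforce
    then show "\<forall>t\<ge>0. \<forall>y\<in>S. (\<Sum>x\<in>S. pmf \<pi> x * trans_prob S R t x y) = pmf \<pi> y"
      by (simp add: b0)
  qed
  then show ?thesis
    unfolding is_stationary_def by simp
qed

text \<open>Eliminating a state \<open>s\<close> and rerouting its inflow along its outgoing rates preserves
  invariance on the remaining states.\<close>

lemma invariant_exists:
  assumes "finite S" "S \<noteq> {}" "\<And>x y. x \<in> S \<Longrightarrow> y \<in> S \<Longrightarrow> 0 \<le> R x y"
  shows "\<exists>p. (\<forall>x\<in>S. 0 \<le> p x) \<and> (\<exists>x\<in>S. 0 < p x) \<and> invariant S R p"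
  using assms
proof (induction S arbitrary: R rule: finite_ne_induct)
  case (singleton s)
  then show ?case
    by (intro exI[of _ "\<lambda>_. 1"]) (simp add: invariant_def)
next
  case (insert s S)
  define D where "D = (\<Sum>z\<in>S. R s z)"
  have sum_S: "(\<Sum>x\<in>insert s S. h x) = h s + (\<Sum>x\<in>S. h x)" for h :: "_ \<Rightarrow> real"
    using insert.hyps by simp
  have "D \<ge> 0"
    unfolding D_def using insert.prems by (intro sum_nonneg) auto
  show ?case
  proof (cases "D = 0")
    case True
    then have "R s y = 0" if "y \<in> S" for y
      using that insert.hyps insert.prems by (simp add: D_def sum_nonneg_eq_0_iff)
    \<comment> \<open>No rate leads from \<open>s\<close> into \<open>S\<close>, so the unit mass at
      \<open>s\<close> is invariant.\<close>
    then show ?thesis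
      using True insert.hyps(3)
      by (intro exI[of _ "\<lambda>x. if x = s then 1 else 0"])
        (auto simp: invariant_def sum_S D_def[symmetric] intro!: sum.neutral)
  next
    case False
    with \<open>D \<ge> 0\<close> have D: "D > 0" by simp
    \<comment> \<open>These are the rates of the chain watched only on \<open>S\<close>: an
      excursion to \<open>s\<close> returns at \<open>y\<close> with probability
      \<open>R s y / D\<close>.\<close>
    define R' where "R' x y = R x y + R x s * R s y / D" for x y
    obtain p where p: "\<And>x. x \<in> S \<Longrightarrow> 0 \<le> p x" "\<exists>x\<in>S. 0 < p x" "invariant S R' p"
    proof -
      have "0 \<le> R' x y" if "x \<in> S" "y \<in> S" for x y
        using that D insert.prems by (simp add: R'_def)
      then show thesis
        using insert.IH[of R'] that by blast
    qed
    \<comment> \<open>The mass at \<open>s\<close> is the one dictated by balance at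
      \<open>s\<close>.\<close>
    define p' where "p' = p(s := (\<Sum>x\<in>S. p x * R x s) / D)"
    have p'[simp]: "p' x = p x" if "x \<in> S" for x
      using that insert.hyps by (auto simp: p'_def)
    have p's: "p' s = (\<Sum>x\<in>S. p x * R x s) / D"
      by (simp add: p'_def)
    have "(\<Sum>x\<in>insert s S. p' x * R x y) = p' y * (\<Sum>z\<in>insert s S. R y z)"
      if "y \<in> insert s S" for y
    proof (cases "y = s")
      case True
      then show ?thesis
        using D by (simp add: sum_S p's D_def[symmetric] field_simps)
    next
      case False
      with that have y: "y \<in> S" by simp
      have "(\<Sum>x\<in>insert s S. p' x * R x y) = (\<Sum>x\<in>S. p x * R' x y)"
        unfolding sum_S p's R'_def
        by (simp add: sum_distrib_left sum_divide_distrib distrib_left sum.distrib mult_ac)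
      also have "\<dots> = p y * (\<Sum>z\<in>S. R' y z)"
        using p(3) y by (auto simp: invariant_def)
      also have "(\<Sum>z\<in>S. R' y z) = (\<Sum>z\<in>S. R y z) + R y s"
        unfolding R'_def sum.distrib using D
        by (simp add: D_def flip: sum_divide_distrib sum_distrib_left)
      finally show ?thesis
        using y by (simp add: sum_S add.commute)
    qed
    moreover have "0 \<le> p' x" if "x \<in> insert s S" for x
    proof (cases "x = s")
      case True
      then show ?thesis
        unfolding True p's using D p(1) insert.prems
        by (intro divide_nonneg_pos sum_nonneg mult_nonneg_nonneg) auto
    qed (use that p(1) in auto)
    moreover have "\<exists>x\<in>insert s S. 0 < p' x"
      using p(2) by auto
    ultimately show ?thesis
      unfolding invariant_def by blast
  qed
qed

section \<open>Positivity and uniqueness of invariant measures\<close>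

lemma accessible_refl: "accessible S R x x"
  by (simp add: accessible_def)

lemma accessible_trans: "accessible S R x y \<Longrightarrow> accessible S R y z \<Longrightarrow> accessible S R x z"
  unfolding accessible_def by (rule rtranclp_trans)

lemma accessible_in:
  assumes "accessible S R x y" "x \<in> S"
  shows "y \<in> S"
  using assms unfolding accessible_def by (induction rule: rtranclp_induct) auto

text \<open>If \<open>p y = 0\<close>, balance at \<open>y\<close> makes the total inflow vanish,
  hence each of its nonnegative terms.\<close>

lemma invariant_pos_step:
  assumes "finite S" and nn: "\<And>x y. x \<in> S \<Longrightarrow> y \<in> S \<Longrightarrow> 0 \<le> R x y"
    and p: "\<And>x. x \<in> S \<Longrightarrow> 0 \<le> p x" "invariant S R p"
    and x: "x \<in> S" "0 < p x" and y: "y \<in> S" "R x y > 0"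
  shows "0 < p y"
proof (rule ccontr)
  assume "\<not> 0 < p y"
  with p(1) y(1) have "p y = 0" by force
  then have "(\<Sum>x\<in>S. p x * R x y) = 0"
    using p(2) y(1) by (simp add: invariant_def)
  then have "p x * R x y = 0"
    using assms(1) x y nn p(1) by (subst (asm) sum_nonneg_eq_0_iff) auto
  with x y show False by simp
qed

lemma invariant_pos_accessible:
  assumes "finite S" and "\<And>x y. x \<in> S \<Longrightarrow> y \<in> S \<Longrightarrow> 0 \<le> R x y"
    and "\<And>x. x \<in> S \<Longrightarrow> 0 \<le> p x" "invariant S R p"
    and "x \<in> S" "0 < p x" and "accessible S R x y"
  shows "0 < p y"
  using assms(7,6) unfolding accessible_def
  by (induction rule: rtranclp_induct) (use invariant_pos_step[OF assms(1-4)] in blast)+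

text \<open>Dropping the negative entries can only raise the inflow of a state, so the positive part
  has a nonnegative surplus of inflow over outflow everywhere. Summed over \<open>S\<close> the
  surpluses cancel, so each of them is zero.\<close>

lemma invariant_pos_part:
  assumes "finite S" and nn: "\<And>x y. x \<in> S \<Longrightarrow> y \<in> S \<Longrightarrow> 0 \<le> R x y" and inv: "invariant S R v"
  shows "invariant S R (\<lambda>x. max 0 (v x))"
proof -
  define p where "p x = max 0 (v x)" for x
  define d where "d y = (\<Sum>x\<in>S. p x * R x y) - p y * (\<Sum>z\<in>S. R y z)" for y
  have "d y \<ge> 0" if y: "y \<in> S" for y
  proof (cases "v y \<ge> 0")
    case True
    have "v y * (\<Sum>z\<in>S. R y z) = (\<Sum>x\<in>S. v x * R x y)"
      using inv y by (simp add: invariant_def)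
    also have "\<dots> \<le> (\<Sum>x\<in>S. p x * R x y)"
      using y nn by (intro sum_mono mult_right_mono) (auto simp: p_def)
    finally have "v y * (\<Sum>z\<in>S. R y z) \<le> (\<Sum>x\<in>S. p x * R x y)" .
    with True show ?thesis by (simp add: d_def p_def)
  next
    case False
    then show ?thesis
      using nn y by (auto simp: d_def p_def intro!: sum_nonneg)
  qed
  moreover have "(\<Sum>y\<in>S. d y) = 0"
    unfolding d_def sum_subtractf sum_distrib_left by (subst sum.swap) simp
  ultimately have "\<forall>y\<in>S. d y = 0"
    using assms(1) by (subst (asm) sum_nonneg_eq_0_iff) auto
  then show ?thesis
    by (simp add: invariant_def d_def p_def)
qed

text \<open>The difference of two stationary laws is a signed invariant vector. If it is positive
  anywhere, its positive part is invariant and therefore positive at \<open>c\<close>. Both signs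
  cannot occur at \<open>c\<close>, so one law dominates the other, and equal total mass forces
  equality.\<close>

lemma stationary_unique:
  assumes fin: "finite S" and nn: "\<And>x y. x \<in> S \<Longrightarrow> y \<in> S \<Longrightarrow> 0 \<le> R x y"
    and hub: "\<And>x. x \<in> S \<Longrightarrow> accessible S R x c"
    and st: "is_stationary S R \<pi>" "is_stationary S R \<pi>'"
  shows "\<pi> = \<pi>'"
proof -
  have sub: "set_pmf \<pi> \<subseteq> S" "set_pmf \<pi>' \<subseteq> S"
    and inv: "invariant S R (pmf \<pi>)" "invariant S R (pmf \<pi>')"
    using st by (auto simp: is_stationary_iff_invariant[OF fin])
  have inv_diff: "invariant S R (\<lambda>x. pmf \<pi>\<^sub>1 x - pmf \<pi>\<^sub>2 x)"
    if "invariant S R (pmf \<pi>\<^sub>1)" "invariant S R (pmf \<pi>\<^sub>2)" for \<pi>\<^sub>1 \<pi>\<^sub>2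
    using that by (simp add: invariant_def left_diff_distrib sum_subtractf)
  have pos: "pmf \<pi>\<^sub>1 c > pmf \<pi>\<^sub>2 c"
    if "invariant S R (pmf \<pi>\<^sub>1)" "invariant S R (pmf \<pi>\<^sub>2)" "x \<in> S" "pmf \<pi>\<^sub>1 x > pmf \<pi>\<^sub>2 x" for \<pi>\<^sub>1 \<pi>\<^sub>2 x
    using invariant_pos_accessible[OF fin nn _ invariant_pos_part[OF fin nn inv_diff[OF that(1,2)]]
        that(3) _ hub] that(3,4) by simp
  have le: "(\<forall>x\<in>S. pmf \<pi> x \<le> pmf \<pi>' x) \<or> (\<forall>x\<in>S. pmf \<pi>' x \<le> pmf \<pi> x)"
    using pos[OF inv] pos[OF inv(2,1)] by (meson not_less order.asym)
  have "(\<Sum>x\<in>S. pmf \<pi> x) = 1" "(\<Sum>x\<in>S. pmf \<pi>' x) = 1"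
    using sub fin by (auto intro: sum_pmf_eq_1)
  then have sum_eq: "(\<Sum>x\<in>S. pmf \<pi> x) = (\<Sum>x\<in>S. pmf \<pi>' x)" by simp
  have "pmf \<pi> x = pmf \<pi>' x" if "x \<in> S" for x
    using le sum_mono_inv[OF sum_eq _ that fin] sum_mono_inv[OF sum_eq[symmetric] _ that fin]
    by auto
  moreover have "pmf \<pi> x = pmf \<pi>' x" if "x \<notin> S" for x
    using that sub by (metis pmf_eq_0_set_pmf subsetD)
  ultimately show ?thesis
    by (intro pmf_eqI) auto
qed

lemma stationary_dist_eq:
  assumes "finite S" and "\<And>x y. x \<in> S \<Longrightarrow> y \<in> S \<Longrightarrow> 0 \<le> R x y"
    and "\<And>x. x \<in> S \<Longrightarrow> accessible S R x c" and "is_stationary S R \<pi>"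
  shows "stationary_dist S R = \<pi>"
  unfolding stationary_dist_def using stationary_unique[OF assms(1-3)] assms(4) by blast

lemma normalized_invariant_stationary:
  assumes "finite S" and nn: "\<And>x. x \<in> S \<Longrightarrow> 0 \<le> p x"
    and pos: "0 < (\<Sum>x\<in>S. p x)" and inv: "invariant S R p"
  obtains \<pi> where "is_stationary S R \<pi>" "\<And>x. x \<in> S \<Longrightarrow> pmf \<pi> x = p x / (\<Sum>x\<in>S. p x)"
proof -
  define w where "w x = (if x \<in> S then p x / (\<Sum>x\<in>S. p x) else 0)" for x
  have w: "w x = p x / (\<Sum>x\<in>S. p x)" if "x \<in> S" for x
    using that by (simp add: w_def)
  have w0: "0 \<le> w x" for x
    using nn pos by (simp add: w_def)
  have "(\<Sum>x\<in>S. w x) = 1"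
    using pos by (simp add: w flip: sum_divide_distrib)
  moreover have "(\<integral>\<^sup>+x. ennreal (w x) \<partial>count_space UNIV) = (\<integral>\<^sup>+x. ennreal (w x) \<partial>count_space S)"
    by (subst nn_integral_count_space_indicator)
      (auto intro!: nn_integral_cong simp: w_def indicator_def)
  ultimately have one: "(\<integral>\<^sup>+x. ennreal (w x) \<partial>count_space UNIV) = 1"
    using assms(1) w0 by (simp add: nn_integral_count_space_finite sum_ennreal)
  have pmf_eq: "pmf (embed_pmf w) x = w x" for x
    by (rule pmf_embed_pmf[OF w0 one])
  have "set_pmf (embed_pmf w) \<subseteq> S"
    by (auto simp: set_pmf_iff pmf_eq w_def split: if_splits)
  moreover have "invariant S R w"
    using inv by (simp add: invariant_def w flip: sum_divide_distrib)
  ultimately have "is_stationary S R (embed_pmf w)"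
    unfolding is_stationary_iff_invariant[OF assms(1)] by (simp add: pmf_eq invariant_def)
  then show ?thesis
    using that pmf_eq w by simp
qed

text \<open>Among the states accessible from \<open>x\<close>, one with the fewest accessible states
  is recurrent: whatever it reaches has the same accessible set, which contains the way
  back.\<close>

lemma recurrent_state_exists:
  assumes "finite S" "x \<in> S"
  obtains y where "accessible S R x y" "recurrent_state S R y"
proof -
  define A where "A y = {z. accessible S R y z}" for y
  have fin: "finite (A y)" if "y \<in> S" for y
    using assms(1) accessible_in that unfolding A_def by (metis finite_subset mem_Collect_eq subsetI)
  obtain y where y: "accessible S R x y" "\<And>z. accessible S R x z \<Longrightarrow> card (A y) \<le> card (A z)"
    using ex_has_least_nat[of "accessible S R x" x "\<lambda>z. card (A z)", OF accessible_refl] by blast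
  have yS: "y \<in> S" by (rule accessible_in[OF y(1) assms(2)])
  have "accessible S R z y" if z: "accessible S R y z" for z
  proof -
    have "A z \<subseteq> A y"
      using z by (auto simp: A_def intro: accessible_trans)
    moreover have "card (A y) \<le> card (A z)"
      by (rule y(2)[OF accessible_trans[OF y(1) z]])
    ultimately have "A z = A y"
      using fin yS by (meson card_seteq)
    moreover have "y \<in> A y" by (simp add: A_def accessible_refl)
    ultimately have "y \<in> A z" by simp
    then show ?thesis by (simp add: A_def)
  qed
  with y(1) yS show ?thesis
    using that by (auto simp: recurrent_state_def)
qed

text \<open>Every state leads to a recurrent one, which must lie in the only class and hence
  communicates with \<open>c\<close>.\<close>

lemma single_recurrent_class_imp_hub:
  assumes "finite S" "single_recurrent_class S R"
  shows "\<exists>c\<in>S. \<forall>x\<in>S. accessible S R x c"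
proof -
  let ?cls = "\<lambda>x. {y. accessible S R x y \<and> accessible S R y x}"
  obtain C where C: "C \<in> recurrent_classes S R" and uniq: "\<And>D. D \<in> recurrent_classes S R \<Longrightarrow> D = C"
    using assms(2) unfolding single_recurrent_class_def by blast
  obtain c where c: "recurrent_state S R c" "C = ?cls c"
    using C unfolding recurrent_classes_def by blast
  have "accessible S R x c" if x: "x \<in> S" for x
  proof -
    obtain y where y: "accessible S R x y" "recurrent_state S R y"
      using recurrent_state_exists[OF assms(1) x] .
    then have "?cls y = ?cls c"
      using uniq c(2) unfolding recurrent_classes_def by blast
    moreover have "c \<in> ?cls c" by (simp add: accessible_refl)
    ultimately have "accessible S R y c" by blast
    with y(1) show ?thesis
      by (rule accessible_trans)
  qed
  with c(1) show ?thesis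
    by (auto simp: recurrent_state_def)
qed

section \<open>Global balance tested against functions\<close>

text \<open>Taking \<open>h\<close> as the indicator of \<open>y\<close> recovers balance at
  \<open>y\<close>. The tested form suits rates that are sums over transitions: the ways of entering
  a given state never have to be enumerated.\<close>

lemma invariantI_weak:
  assumes "finite S" and weak: "\<And>h. (\<Sum>x\<in>S. p x * (\<Sum>y\<in>S. R x y * (h y - h x))) = 0"
  shows "invariant S R p"
  unfolding invariant_def
proof
  fix y assume y: "y \<in> S"
  define h :: "_ \<Rightarrow> real" where "h z = (if z = y then 1 else 0)" for z
  have delta: "(\<Sum>z\<in>S. k z * h z) = k y" for k
    using y assms(1) by (simp add: h_def if_distrib[of "(*) _"] sum.delta cong: if_cong)
  have "(\<Sum>x\<in>S. p x * (\<Sum>z\<in>S. R x z * (h z - h x))) =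
      (\<Sum>x\<in>S. p x * (R x y - (\<Sum>z\<in>S. R x z) * h x))"
    by (simp add: right_diff_distrib sum_subtractf delta flip: sum_distrib_right)
  also have "\<dots> = (\<Sum>x\<in>S. p x * R x y) - (\<Sum>x\<in>S. (p x * (\<Sum>z\<in>S. R x z)) * h x)"
    by (simp add: right_diff_distrib sum_subtractf mult.assoc)
  also have "\<dots> = (\<Sum>x\<in>S. p x * R x y) - p y * (\<Sum>z\<in>S. R y z)"
    unfolding delta ..
  finally show "(\<Sum>x\<in>S. p x * R x y) = p y * (\<Sum>z\<in>S. R y z)" using weak[of h] by simp
qed

lemma invariant_weak:
  assumes "invariant S R p"
  shows "(\<Sum>x\<in>S. p x * (\<Sum>y\<in>S. R x y * (h y - h x))) = 0"
proof -
  have "(\<Sum>x\<in>S. p x * (\<Sum>y\<in>S. R x y * (h y - h x))) =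
      (\<Sum>x\<in>S. \<Sum>y\<in>S. p x * R x y * h y) - (\<Sum>x\<in>S. h x * (p x * (\<Sum>y\<in>S. R x y)))"
    by (simp add: right_diff_distrib sum_subtractf sum_distrib_left mult_ac)
  also have "(\<Sum>x\<in>S. h x * (p x * (\<Sum>y\<in>S. R x y))) = (\<Sum>x\<in>S. h x * (\<Sum>y\<in>S. p y * R y x))"
    using assms by (simp add: invariant_def)
  also have "\<dots> = (\<Sum>x\<in>S. \<Sum>y\<in>S. p x * R x y * h y)"
    unfolding sum_distrib_left by (subst sum.swap) (simp add: mult_ac)
  finally show ?thesis by simp
qed

section \<open>Transitions and mean flows\<close>

lemma member_le_double_sum:
  fixes g :: "'a \<Rightarrow> 'b \<Rightarrow> real"
  assumes "finite A" "\<And>i. i \<in> A \<Longrightarrow> finite (B i)" "\<And>i j. i \<in> A \<Longrightarrow> j \<in> B i \<Longrightarrow> 0 \<le> g i j"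
    and "i \<in> A" "j \<in> B i"
  shows "g i j \<le> (\<Sum>i\<in>A. \<Sum>j\<in>B i. g i j)"
proof -
  have "g i j \<le> (\<Sum>j\<in>B i. g i j)"
    using assms by (intro member_le_sum) auto
  also have "\<dots> \<le> (\<Sum>i\<in>A. \<Sum>j\<in>B i. g i j)"
    using assms by (intro member_le_sum[of i A "\<lambda>i. \<Sum>j\<in>B i. g i j"] sum_nonneg) auto
  finally show ?thesis .
qed

lemma sum_mult_double_sum:
  fixes p :: "'x \<Rightarrow> real"
  shows "(\<Sum>x\<in>S. p x * (\<Sum>i\<in>A. \<Sum>j\<in>B i. g x i j)) = (\<Sum>i\<in>A. \<Sum>j\<in>B i. \<Sum>x\<in>S. p x * g x i j)"
  unfolding sum_distrib_left
  by (subst sum.swap, intro sum.cong refl, subst sum.swap) simp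

lemma inc_apply: "inc M a b i j = M i j + (if i = a \<and> j = b then 1 else 0)"
  by (simp add: inc_def)

lemma dec_apply: "dec M a b i j = M i j - (if i = a \<and> j = b then 1 else 0)"
  by (simp add: dec_def)

lemma dec_inc [simp]: "dec (inc M i j) i j = M"
  by (auto simp: inc_def dec_def)

lemma inc_dec: "0 < M i j \<Longrightarrow> inc (dec M i j) i j = M"
  by (auto simp: inc_def dec_def)

lemma sum_inc:
  fixes u :: "'r::finite \<Rightarrow> 'r \<Rightarrow> 'a::comm_semiring_1"
  shows "(\<Sum>i\<in>UNIV. \<Sum>j\<in>UNIV. u i j * of_nat (inc M a b i j)) =
         (\<Sum>i\<in>UNIV. \<Sum>j\<in>UNIV. u i j * of_nat (M i j)) + u a b"
proof -
  have "(\<Sum>i\<in>UNIV. \<Sum>j\<in>UNIV. u i j * of_nat (inc M a b i j)) =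
      (\<Sum>i\<in>UNIV. \<Sum>j\<in>UNIV. u i j * of_nat (M i j) +
        (if i = a then if j = b then u i j else 0 else 0))"
    by (intro sum.cong refl) (simp add: inc_apply distrib_left)
  also have "\<dots> = (\<Sum>i\<in>UNIV. \<Sum>j\<in>UNIV. u i j * of_nat (M i j)) +
      (\<Sum>i\<in>UNIV. if i = a then u a b else 0)"
    unfolding sum.distrib by (intro arg_cong2[of _ _ _ _ "(+)"] sum.cong refl) (simp add: sum.delta)
  finally show ?thesis by (simp add: sum.delta)
qed

text \<open>The semiring is left open so that one definition serves the natural numbers (number of
  cars, potential in \<open>static_hub\<close>) and the reals (test functions).\<close>

definition linear_obs ::
  "('r \<Rightarrow> 'r \<Rightarrow> 'a) \<Rightarrow> ('r \<Rightarrow> 'r \<Rightarrow> 'a) \<Rightarrow> 'r::finite state \<Rightarrow> 'a::comm_semiring_1" where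
  "linear_obs u v x = (\<Sum>i\<in>UNIV. \<Sum>j\<in>UNIV. u i j * of_nat (fst x i j)) +
                      (\<Sum>i\<in>UNIV. \<Sum>j\<in>UNIV. v i j * of_nat (snd x i j))"

lemma linear_obs_inc [simp]:
  "linear_obs u v (inc E i j, F) = linear_obs u v (E, F) + u i j"
  "linear_obs u v (E, inc F i j) = linear_obs u v (E, F) + v i j"
  by (simp_all add: linear_obs_def sum_inc add_ac)

lemma mem_states_iff: "x \<in> states N \<longleftrightarrow> linear_obs (\<lambda>_ _. 1) (\<lambda>_ _. 1) x = N"
  by (cases x) (simp add: states_def linear_obs_def sum.distrib)

lemma inc_mem_states [simp]:
  "(inc E i j, F) \<in> states (Suc M) \<longleftrightarrow> (E, F) \<in> states M"
  "(E, inc F i j) \<in> states (Suc M) \<longleftrightarrow> (E, F) \<in> states M"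
  by (simp_all add: mem_states_iff)

lemma inc_mem_states_pos:
  "(inc E i j, F) \<in> states N \<longleftrightarrow> (\<exists>M. N = Suc M \<and> (E, F) \<in> states M)"
  "(E, inc F i j) \<in> states N \<longleftrightarrow> (\<exists>M. N = Suc M \<and> (E, F) \<in> states M)"
  by (auto simp: mem_states_iff)

lemma move_mem_states:
  assumes "(E, F) \<in> states N"
  shows "0 < E i j \<Longrightarrow> (dec E i j, inc F k l) \<in> states N"
    and "0 < E i j \<Longrightarrow> (inc (dec E i j) k l, F) \<in> states N"
    and "0 < F i j \<Longrightarrow> (inc E k l, dec F i j) \<in> states N"
proof -
  show "(dec E i j, inc F k l) \<in> states N" "(inc (dec E i j) k l, F) \<in> states N" if "0 < E i j"
    using assms inc_dec[of E i j, OF that] inc_mem_states_pos(1)[of "dec E i j" i j F N] by auto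
  show "(inc E k l, dec F i j) \<in> states N" if "0 < F i j"
    using assms inc_dec[of F i j, OF that] inc_mem_states_pos(2)[of E "dec F i j" i j N] by auto
qed

lemma scaled_mem_fluid_space:
  assumes "(E, F) \<in> states N" "N > 0"
  shows "(scaled N E, scaled N F) \<in> fluid_space"
proof -
  have total: "(\<Sum>i\<in>UNIV. \<Sum>j\<in>UNIV. E i j + F i j) = N"
    using assms by (simp add: states_def)
  have "E i j + F i j \<le> N" for i j
    using member_le_sum[of j UNIV "\<lambda>j. E i j + F i j"]
      member_le_sum[of i UNIV "\<lambda>i. \<Sum>j\<in>UNIV. E i j + F i j"] total by force
  then have "E i j \<le> N" "F i j \<le> N" for i j
    using le_trans le_add1 le_add2 by metis+
  moreover have "(\<Sum>i\<in>UNIV. \<Sum>j\<in>UNIV. real (E i j) + real (F i j)) = real N"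
    unfolding total[symmetric] by simp
  ultimately show ?thesis
    using assms(2)
    by (auto simp: fluid_space_def scaled_def divide_le_eq_1 simp flip: add_divide_distrib sum_divide_distrib)
qed

section \<open>The action of the generator on functions of the state\<close>

text \<open>Summed over transitions rather than over target states, so that coinciding targets need
  no attention.\<close>

definition drift ::
  "(('r::finite) \<Rightarrow> real) \<Rightarrow> 'r mat \<Rightarrow> 'r mat \<Rightarrow> ('r mat \<times> 'r mat \<Rightarrow> 'r mat) \<Rightarrow> nat \<Rightarrow>
   ('r state \<Rightarrow> real) \<Rightarrow> 'r state \<Rightarrow> real" where
  "drift lam mu P Q N h = (\<lambda>(E, F).
     (\<Sum>i\<in>UNIV. \<Sum>j\<in>UNIV. (if E i i > 0 then real N * lam i * P i j else 0) *
        (h (dec E i i, inc F i j) - h (E, F)))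
   + (\<Sum>i\<in>UNIV. \<Sum>j\<in>UNIV. \<Sum>k\<in>UNIV. mu i j * real (F i j) * Q (scaled N E, scaled N F) j k *
        (h (inc E j k, dec F i j) - h (E, F)))
   + (\<Sum>i\<in>UNIV. \<Sum>j\<in>UNIV - {i}. mu i j * real (E i j) *
        (h (inc (dec E i j) j j, F) - h (E, F))))"

lemma sum_rate_eq_drift:
  assumes "x \<in> states N"
  shows "(\<Sum>y\<in>states N. rate lam mu P Q N x y * (h y - h x)) = drift lam mu P Q N h x"
proof -
  obtain E F where x: "x = (E, F)" by force
  with assms have EF: "(E, F) \<in> states N" by simp
  \<comment> \<open>A transition of nonzero rate stays inside \<open>states N\<close>; one that
    would decrement a zero entry has rate zero and contributes nothing, wherever truncated
    subtraction leads.\<close>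
  have jump: "(\<Sum>y\<in>states N. d y * (if y = t then r else 0)) = r * d t"
    if "r \<noteq> 0 \<Longrightarrow> t \<in> states N" for r t and d :: "_ \<Rightarrow> real"
    using that
    by (cases "r = 0") (simp_all add: if_distrib[of "(*) _"] sum.delta[OF finite_states] cong: if_cong)
  have "(\<Sum>y\<in>states N. rate lam mu P Q N x y * (h y - h x)) =
      (\<Sum>y\<in>states N. (h y - h x) * (\<Sum>i\<in>UNIV. \<Sum>j\<in>UNIV.
          if y = (dec E i i, inc F i j) then if E i i > 0 then real N * lam i * P i j else 0 else 0)) +
      (\<Sum>y\<in>states N. (h y - h x) * (\<Sum>i\<in>UNIV. \<Sum>j\<in>UNIV. \<Sum>k\<in>UNIV.
          if y = (inc E j k, dec F i j)
          then mu i j * real (F i j) * Q (scaled N E, scaled N F) j k else 0)) +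
      (\<Sum>y\<in>states N. (h y - h x) * (\<Sum>i\<in>UNIV. \<Sum>j\<in>UNIV - {i}.
          if y = (inc (dec E i j) j j, F) then mu i j * real (E i j) else 0))"
    unfolding x rate_def sum.distrib[symmetric] distrib_left[symmetric] prod.case
    by (intro sum.cong refl)
      (simp add: mult.commute if_if_eq_conj conj_commute)
  also have "\<dots> = drift lam mu P Q N h x"
    unfolding x drift_def prod.case
  proof (intro arg_cong2[of _ _ _ _ "(+)"], goal_cases)
    case 1
    have "(\<Sum>y\<in>states N. (h y - h (E, F)) * (if y = (dec E i i, inc F i j)
            then if E i i > 0 then real N * lam i * P i j else 0 else 0)) =
          (if E i i > 0 then real N * lam i * P i j else 0) * (h (dec E i i, inc F i j) - h (E, F))" for i j
      using move_mem_states(1)[OF EF] by (subst jump) (auto split: if_splits)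
    then show ?case
      unfolding sum_mult_double_sum by simp
  next
    case 2
    have "(\<Sum>y\<in>states N. (h y - h (E, F)) * (if y = (inc E j k, dec F i j)
            then mu i j * real (F i j) * Q (scaled N E, scaled N F) j k else 0)) =
          mu i j * real (F i j) * Q (scaled N E, scaled N F) j k * (h (inc E j k, dec F i j) - h (E, F))"
      for i j k
      by (subst jump) (auto intro!: move_mem_states(3)[OF EF] gr0I)
    then show ?case
      unfolding sum_mult_double_sum
      by (simp add: sum_distrib_left sum.swap[of _ _ "states N"])
  next
    case 3
    have "(\<Sum>y\<in>states N. (h y - h (E, F)) * (if y = (inc (dec E i j) j j, F)
            then mu i j * real (E i j) else 0)) =
          mu i j * real (E i j) * (h (inc (dec E i j) j j, F) - h (E, F))" for i j
      by (subst jump) (auto intro!: move_mem_states(2)[OF EF] gr0I)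
    then show ?case
      unfolding sum_mult_double_sum by simp
  qed
  finally show ?thesis .
qed

lemma rate_nonneg:
  assumes "\<And>i. lam i > 0" "\<And>i j. mu i j > 0" "row_stochastic P" "routing_policy Q" "N > 0"
    and "x \<in> states N"
  shows "0 \<le> rate lam mu P Q N x y"
proof -
  obtain E F where x: "x = (E, F)" by force
  have "row_stochastic (Q (scaled N E, scaled N F))"
    using assms(4) scaled_mem_fluid_space[OF assms(6)[unfolded x] assms(5)]
    by (auto simp: routing_policy_def)
  then have "0 \<le> P i j" "0 \<le> Q (scaled N E, scaled N F) i j" "0 \<le> lam i" "0 \<le> mu i j" for i j
    using assms(1-3) by (auto simp: row_stochastic_def less_imp_le)
  then show ?thesis
    unfolding x rate_def prod.case by (intro add_nonneg_nonneg sum_nonneg) simp_all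
qed

text \<open>\<open>rate\<close> adds up all transitions with the same target, so a single transition
  only bounds it from below; this is enough for positivity.\<close>

lemma rate_ge:
  assumes "\<And>i. lam i > 0" "\<And>i j. mu i j > 0" "row_stochastic P" "routing_policy Q" "N > 0"
    and EF: "(E, F) \<in> states N"
  shows "E i i > 0 \<Longrightarrow> real N * lam i * P i j \<le> rate lam mu P Q N (E, F) (dec E i i, inc F i j)"
    and "mu i j * real (F i j) * Q (scaled N E, scaled N F) j k
           \<le> rate lam mu P Q N (E, F) (inc E j k, dec F i j)"
    and "i \<noteq> j \<Longrightarrow> mu i j * real (E i j) \<le> rate lam mu P Q N (E, F) (inc (dec E i j) j j, F)"
proof -
  have "row_stochastic (Q (scaled N E, scaled N F))"
    using assms(4) scaled_mem_fluid_space[OF EF assms(5)] by (auto simp: routing_policy_def)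
  then have nn: "0 \<le> P i j" "0 \<le> Q (scaled N E, scaled N F) i j" "0 \<le> lam i" "0 \<le> mu i j" for i j
    using assms(1-3) by (auto simp: row_stochastic_def less_imp_le)
  define g1 where "g1 y i j =
    (if E i i > 0 \<and> y = (dec E i i, inc F i j) then real N * lam i * P i j else 0)" for y i j
  define g2 where "g2 y i j k =
    (if y = (inc E j k, dec F i j)
     then mu i j * real (F i j) * Q (scaled N E, scaled N F) j k else 0)" for y i j k
  define g3 where "g3 y i j = (if y = (inc (dec E i j) j j, F) then mu i j * real (E i j) else 0)" for y i j
  have g: "0 \<le> g1 y i j" "0 \<le> g2 y i j k" "0 \<le> g3 y i j" for y i j k
    using nn by (auto simp: g1_def g2_def g3_def)
  have rate: "rate lam mu P Q N (E, F) y = (\<Sum>i\<in>UNIV. \<Sum>j\<in>UNIV. g1 y i j) +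
      (\<Sum>i\<in>UNIV. \<Sum>j\<in>UNIV. \<Sum>k\<in>UNIV. g2 y i j k) + (\<Sum>i\<in>UNIV. \<Sum>j\<in>UNIV - {i}. g3 y i j)" for y
    by (simp add: rate_def g1_def g2_def g3_def)
  have nonneg: "0 \<le> (\<Sum>i\<in>UNIV. \<Sum>j\<in>UNIV. g1 y i j)" "0 \<le> (\<Sum>i\<in>UNIV. \<Sum>j\<in>UNIV. \<Sum>k\<in>UNIV. g2 y i j k)"
    "0 \<le> (\<Sum>i\<in>UNIV. \<Sum>j\<in>UNIV - {i}. g3 y i j)" for y
    by (intro sum_nonneg g)+
  have g1_le: "g1 y i j \<le> rate lam mu P Q N (E, F) y" for y i j
    using member_le_double_sum[of UNIV "\<lambda>_. UNIV" "g1 y" i j] g nonneg[of y] by (simp add: rate)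
  have g2_le: "g2 y i j k \<le> rate lam mu P Q N (E, F) y" for y i j k
  proof -
    have "g2 y i j k \<le> (\<Sum>k\<in>UNIV. g2 y i j k)"
      using g by (intro member_le_sum) auto
    also have "\<dots> \<le> (\<Sum>i\<in>UNIV. \<Sum>j\<in>UNIV. \<Sum>k\<in>UNIV. g2 y i j k)"
      using g by (intro member_le_double_sum sum_nonneg) auto
    also have "\<dots> \<le> rate lam mu P Q N (E, F) y"
      using nonneg[of y] by (simp add: rate)
    finally show ?thesis .
  qed
  have g3_le: "g3 y i j \<le> rate lam mu P Q N (E, F) y" if "i \<noteq> j" for y i j
    using member_le_double_sum[of UNIV "\<lambda>i. UNIV - {i}" "g3 y" i j] g nonneg[of y] that by (simp add: rate)
  show "E i i > 0 \<Longrightarrow> real N * lam i * P i j \<le> rate lam mu P Q N (E, F) (dec E i i, inc F i j)"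
    using g1_le[of "(dec E i i, inc F i j)" i j] by (simp add: g1_def)
  show "mu i j * real (F i j) * Q (scaled N E, scaled N F) j k
          \<le> rate lam mu P Q N (E, F) (inc E j k, dec F i j)"
    using g2_le[of "(inc E j k, dec F i j)" i j k] by (simp add: g2_def)
  show "i \<noteq> j \<Longrightarrow> mu i j * real (E i j) \<le> rate lam mu P Q N (E, F) (inc (dec E i j) j j, F)"
    using g3_le[of i j "(inc (dec E i j) j j, F)"] by (simp add: g3_def)
qed

text \<open>Summation by parts: the coefficients of \<open>\<phi> i j\<close> and \<open>\<epsilon> i j\<close> are the net inflows of full cars
  into \<open>F i j\<close> and of empty cars into \<open>E i j\<close>, when \<open>U\<close>, \<open>V\<close>, \<open>W\<close> are the flows of the three kinds of
  transitions.\<close>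

lemma net_flow:
  fixes U W \<epsilon> \<phi> :: "'r::finite \<Rightarrow> 'r \<Rightarrow> real"
  shows "(\<Sum>i\<in>UNIV. \<Sum>j\<in>UNIV. U i j * (\<phi> i j - \<epsilon> i i)) +
      (\<Sum>i\<in>UNIV. \<Sum>j\<in>UNIV. \<Sum>k\<in>UNIV. V i j k * (\<epsilon> j k - \<phi> i j)) +
      (\<Sum>i\<in>UNIV. \<Sum>j\<in>UNIV - {i}. W i j * (\<epsilon> j j - \<epsilon> i j)) =
    (\<Sum>i\<in>UNIV. \<Sum>j\<in>UNIV. \<phi> i j * (U i j - (\<Sum>k\<in>UNIV. V i j k))) +
    (\<Sum>i\<in>UNIV. \<Sum>j\<in>UNIV. \<epsilon> i j * ((\<Sum>k\<in>UNIV. V k i j) +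
       (if i = j then (\<Sum>k\<in>UNIV - {i}. W k i) - (\<Sum>k\<in>UNIV. U i k) else - W i j)))"
proof -
  let ?W = "\<lambda>i j. if i = j then 0 else W i j"
  have off: "(\<Sum>k\<in>UNIV - {i}. g k) = (\<Sum>k\<in>UNIV. if i = k then 0 else g k)" for i :: 'r and g :: "'r \<Rightarrow> real"
    by (rule sum.mono_neutral_cong_left) auto
  have U: "(\<Sum>i\<in>UNIV. \<Sum>j\<in>UNIV. U i j * (\<phi> i j - \<epsilon> i i)) =
      (\<Sum>i\<in>UNIV. \<Sum>j\<in>UNIV. \<phi> i j * U i j) - (\<Sum>i\<in>UNIV. \<epsilon> i i * (\<Sum>k\<in>UNIV. U i k))"
    by (simp add: right_diff_distrib sum_subtractf sum_distrib_left mult.commute)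
  have swap: "(\<Sum>i\<in>UNIV. \<Sum>j\<in>UNIV. \<Sum>k\<in>UNIV. \<epsilon> j k * V i j k) =
      (\<Sum>j\<in>UNIV. \<Sum>k\<in>UNIV. \<epsilon> j k * (\<Sum>i\<in>UNIV. V i j k))"
    unfolding sum_distrib_left by (rule trans[OF sum.swap], rule sum.cong[OF refl], rule sum.swap)
  have V: "(\<Sum>i\<in>UNIV. \<Sum>j\<in>UNIV. \<Sum>k\<in>UNIV. V i j k * (\<epsilon> j k - \<phi> i j)) =
      (\<Sum>j\<in>UNIV. \<Sum>k\<in>UNIV. \<epsilon> j k * (\<Sum>i\<in>UNIV. V i j k)) -
      (\<Sum>i\<in>UNIV. \<Sum>j\<in>UNIV. \<phi> i j * (\<Sum>k\<in>UNIV. V i j k))"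
    unfolding swap[symmetric]
    by (simp add: right_diff_distrib sum_subtractf sum_distrib_left mult.commute)
  have "(\<Sum>i\<in>UNIV. \<Sum>j\<in>UNIV - {i}. W i j * (\<epsilon> j j - \<epsilon> i j)) =
      (\<Sum>i\<in>UNIV. \<Sum>j\<in>UNIV. \<epsilon> j j * ?W i j) - (\<Sum>i\<in>UNIV. \<Sum>j\<in>UNIV. \<epsilon> i j * ?W i j)"
    unfolding off sum_subtractf[symmetric] by (intro sum.cong refl) (simp add: algebra_simps)
  also have "(\<Sum>i\<in>UNIV. \<Sum>j\<in>UNIV. \<epsilon> j j * ?W i j) = (\<Sum>j\<in>UNIV. \<epsilon> j j * (\<Sum>i\<in>UNIV - {j}. W i j))"
    unfolding off sum_distrib_left by (subst sum.swap) (intro sum.cong refl, auto)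
  finally have W: "(\<Sum>i\<in>UNIV. \<Sum>j\<in>UNIV - {i}. W i j * (\<epsilon> j j - \<epsilon> i j)) =
      (\<Sum>j\<in>UNIV. \<epsilon> j j * (\<Sum>i\<in>UNIV - {j}. W i j)) -
      (\<Sum>i\<in>UNIV. \<Sum>j\<in>UNIV. \<epsilon> i j * ?W i j)" .
  have diag: "(\<Sum>i\<in>UNIV. \<epsilon> i i * g i) = (\<Sum>i\<in>UNIV. \<Sum>j\<in>UNIV. \<epsilon> i j * (if i = j then g i else 0))" for g
    by (simp add: if_distrib[of "(*) _"] sum.delta' cong: if_cong)
  show ?thesis
    unfolding U V W diag sum_subtractf[symmetric] sum.distrib[symmetric]
    by (intro sum.cong refl) (simp add: algebra_simps)
qed

lemma net_flow_vanishing: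
  fixes U W :: "'r::finite \<Rightarrow> 'r \<Rightarrow> real"
  assumes "\<And>\<epsilon> \<phi>. (\<Sum>i\<in>UNIV. \<Sum>j\<in>UNIV. U i j * (\<phi> i j - \<epsilon> i i)) +
      (\<Sum>i\<in>UNIV. \<Sum>j\<in>UNIV. \<Sum>k\<in>UNIV. V i j k * (\<epsilon> j k - \<phi> i j)) +
      (\<Sum>i\<in>UNIV. \<Sum>j\<in>UNIV - {i}. W i j * (\<epsilon> j j - \<epsilon> i j)) = 0"
  shows "U i j = (\<Sum>k\<in>UNIV. V i j k)"
    and "i \<noteq> j \<Longrightarrow> W i j = (\<Sum>k\<in>UNIV. V k i j)"
    and "(\<Sum>k\<in>UNIV. U i k) = (\<Sum>k\<in>UNIV - {i}. W k i) + (\<Sum>k\<in>UNIV. V k i i)"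
proof -
  define X where "X i j = U i j - (\<Sum>k\<in>UNIV. V i j k)" for i j
  define Y where "Y i j = (\<Sum>k\<in>UNIV. V k i j) +
       (if i = j then (\<Sum>k\<in>UNIV - {i}. W k i) - (\<Sum>k\<in>UNIV. U i k) else - W i j)" for i j
  \<comment> \<open>As \<open>\<epsilon>\<close> and \<open>\<phi>\<close> are arbitrary, they can
    be set equal to the net inflows themselves, which turns the identity into a vanishing sum of
    squares.\<close>
  have "(\<Sum>i\<in>UNIV. \<Sum>j\<in>UNIV. X i j * X i j) + (\<Sum>i\<in>UNIV. \<Sum>j\<in>UNIV. Y i j * Y i j) = 0"
    using assms[of X Y] unfolding net_flow by (simp add: X_def Y_def)
  then have X: "X i j = 0" and Y: "Y i j = 0" for i j
    by (simp_all add: add_nonneg_eq_0_iff sum_nonneg sum_nonneg_eq_0_iff)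
  show "U i j = (\<Sum>k\<in>UNIV. V i j k)"
    using X[of i j] by (simp add: X_def)
  show "i \<noteq> j \<Longrightarrow> W i j = (\<Sum>k\<in>UNIV. V k i j)"
    using Y[of i j] by (simp add: Y_def)
  show "(\<Sum>k\<in>UNIV. U i k) = (\<Sum>k\<in>UNIV - {i}. W k i) + (\<Sum>k\<in>UNIV. V k i i)"
    using Y[of i i] unfolding Y_def by simp
qed

section \<open>The upper bound\<close>

lemma reward_eq: "reward lam P c a = (\<Sum>i\<in>UNIV. a i * (\<Sum>j\<in>UNIV. lam i * P i j * c i j))"
  by (simp add: reward_def sum_distrib_left mult_ac)

lemma reward_scale: "reward lam P c (\<lambda>i. t * a i) = t * reward lam P c a"
  by (simp add: reward_eq sum_distrib_left mult_ac)

lemma reward_pos: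
  assumes "\<And>i. lam i > 0" "\<And>i j. c i j > 0" "row_stochastic P"
    and "\<And>i. 0 \<le> a i" "0 < a k"
  shows "0 < reward lam P c a"
proof -
  have P: "0 \<le> P i j" "(\<Sum>j\<in>UNIV. P i j) = 1" for i j
    using assms(3) by (auto simp: row_stochastic_def)
  have w: "0 < (\<Sum>j\<in>UNIV. lam i * P i j * c i j)" for i
  proof -
    obtain j where "P i j \<noteq> 0"
      using P(2)[of i] by (metis sum.neutral zero_neq_one)
    with P(1)[of i j] have "0 < P i j" by simp
    then show ?thesis
      using assms(1,2) P(1) by (intro sum_pos2[of UNIV j]) (auto simp: less_imp_le)
  qed
  show ?thesis
    unfolding reward_eq using assms(4,5) w
    by (intro sum_pos2[of UNIV k]) (auto simp: less_imp_le)
qed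

lemma sum_off_diagonal:
  fixes g :: "'r::finite \<Rightarrow> 'r \<Rightarrow> real"
  shows "(\<Sum>i\<in>UNIV. \<Sum>j\<in>UNIV. g i j) = (\<Sum>i\<in>UNIV. g i i) + (\<Sum>i\<in>UNIV. \<Sum>j\<in>UNIV - {i}. g i j)"
proof -
  have "(\<Sum>j\<in>UNIV. g i j) = g i i + (\<Sum>j\<in>UNIV - {i}. g i j)" for i
    by (rule sum.remove) auto
  then show ?thesis by (simp add: sum.distrib)
qed

text \<open>Scaling all flows by \<open>\<alpha> > 1\<close> keeps the linear constraints; \<open>\<alpha>\<close> is chosen maximal and the mass
  left over is parked at a region of largest availability, which restores complementarity.\<close>

lemma slack_not_optimal:
  fixes lam :: "'r::finite \<Rightarrow> real"
  assumes pos: "\<And>i. lam i > 0" "\<And>i j. c i j > 0" and P: "row_stochastic P"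
    and flow: "\<And>i j. lam i * P i j * a i = mu i j * f i j"
      "\<And>i j. i \<noteq> j \<Longrightarrow> mu i j * e i j = q i j * (\<Sum>k\<in>UNIV. mu k i * f k i)"
      "\<And>i. lam i * a i =
        (\<Sum>k\<in>UNIV - {i}. mu k i * e k i) + q i i * (\<Sum>k\<in>UNIV. mu k i * f k i)"
    and q: "row_stochastic q"
    and nonneg: "\<And>i j. 0 \<le> e i j" "\<And>i j. 0 \<le> f i j"
    and mass: "(\<Sum>i\<in>UNIV. \<Sum>j\<in>UNIV. e i j + f i j) = 1"
    and a: "\<And>i. 0 \<le> a i" "\<And>i. a i < 1" "0 < a k" "0 < e k k"
  shows "\<exists>q' e' f' a'. fluid_feasible lam mu P q' e' f' a' \<and> reward lam P c a < reward lam P c a'"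
proof -
  \<comment> \<open>The mass in motion: full cars and empty cars on their way to another
    region.\<close>
  define m where "m = 1 - (\<Sum>i\<in>UNIV. e i i)"
  have m: "m = (\<Sum>i\<in>UNIV. \<Sum>j\<in>UNIV - {i}. e i j) + (\<Sum>i\<in>UNIV. \<Sum>j\<in>UNIV. f i j)"
    using mass sum_off_diagonal[of e] by (simp add: m_def sum.distrib)
  have "e k k \<le> (\<Sum>i\<in>UNIV. e i i)"
    using nonneg by (intro member_le_sum) auto
  then have "m < 1" using a(4) by (simp add: m_def)
  obtain i0 where i0: "\<And>i. a i \<le> a i0"
    using Max_in[of "range a"] Max_ge[of "range a"] by (metis UNIV_not_empty empty_is_image finite finite_imageI image_iff rangeI)
  \<comment> \<open>\<open>1 / s\<close> is the largest admissible factor: \<open>m \<le> s\<close>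
    keeps the scaled moving mass at most 1, and \<open>a i0 \<le> s\<close> does the same for all
    availabilities.\<close>
  define s where "s = max m (a i0)"
  have s: "0 < s" "s < 1" "m \<le> s" "a i \<le> s" for i
    using i0[of k] i0[of i] a(2)[of i0] a(3) \<open>m < 1\<close> by (auto simp: s_def)
  define e' where "e' i j = (if i = j then if i = i0 then 1 - m / s else 0 else e i j / s)" for i j
  define f' where "f' i j = f i j / s" for i j
  define a' where "a' i = a i / s" for i
  have e'_nonneg: "0 \<le> e' i j" and f'_nonneg: "0 \<le> f' i j" for i j
    using nonneg s by (auto simp: e'_def f'_def)
  have mass': "(\<Sum>i\<in>UNIV. \<Sum>j\<in>UNIV. e' i j + f' i j) = 1"
  proof -
    have "(\<Sum>i\<in>UNIV. \<Sum>j\<in>UNIV - {i}. e' i j) = (\<Sum>i\<in>UNIV. \<Sum>j\<in>UNIV - {i}. e i j) / s"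
      unfolding sum_divide_distrib by (intro sum.cong refl) (auto simp: e'_def)
    moreover have "(\<Sum>i\<in>UNIV. e' i i) = 1 - m / s"
      by (simp add: e'_def sum.delta)
    ultimately show ?thesis
      by (simp add: sum.distrib sum_off_diagonal[of e'] f'_def m add_divide_distrib flip: sum_divide_distrib)
  qed
  have le1: "e' i j + f' i j \<le> 1" for i j
    using member_le_double_sum[of UNIV "\<lambda>_. UNIV" "\<lambda>i j. e' i j + f' i j" i j] mass'
      e'_nonneg f'_nonneg by simp
  have le1': "e' i j \<le> 1" "f' i j \<le> 1" for i j
    using le1[of i j] e'_nonneg[of i j] f'_nonneg[of i j] by linarith+
  have space: "(e', f') \<in> fluid_space"
    using e'_nonneg f'_nonneg le1' mass' unfolding fluid_space_def by auto
  have feas: "fluid_feasible lam mu P q e' f' a'"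
    unfolding fluid_feasible_def
  proof (intro conjI allI impI space q)
    show "lam i * P i j * a' i = mu i j * f' i j" for i j
      using flow(1)[of i j] by (simp add: a'_def f'_def)
    have d: "(\<Sum>k\<in>UNIV. mu k i * f' k i) = (\<Sum>k\<in>UNIV. mu k i * f k i) / s" for i
      by (simp add: f'_def sum_divide_distrib)
    show "mu i j * e' i j = q i j * (\<Sum>k\<in>UNIV. mu k i * f' k i)" if "i \<noteq> j" for i j
      unfolding d using flow(2)[OF that] that by (simp add: e'_def)
    have "(\<Sum>k\<in>UNIV - {i}. mu k i * e' k i) = (\<Sum>k\<in>UNIV - {i}. mu k i * e k i) / s" for i
      unfolding sum_divide_distrib by (intro sum.cong refl) (auto simp: e'_def)
    then show "lam i * a' i =
        (\<Sum>k\<in>UNIV - {i}. mu k i * e' k i) + q i i * (\<Sum>k\<in>UNIV. mu k i * f' k i)" for i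
      unfolding d using flow(3)[of i] by (simp add: a'_def add_divide_distrib)
    \<comment> \<open>If \<open>s = a i0\<close>, region \<open>i0\<close> is scaled to availability
      1; if \<open>s = m\<close>, no mass is left to park there.\<close>
    show "(1 - a' i) * e' i i = 0" for i
      using s(1) by (auto simp: a'_def e'_def s_def max_def)
    show "0 \<le> a' i" "a' i \<le> 1" for i
      using a(1)[of i] s by (auto simp: a'_def)
  qed
  have "reward lam P c a' = reward lam P c a / s"
    using reward_scale[of lam P c "1 / s" a] by (simp add: a'_def[abs_def])
  moreover have "0 < reward lam P c a"
    by (rule reward_pos[of lam c P a k, OF pos P a(1) a(3)])
  ultimately have "reward lam P c a < reward lam P c a'"
    using s(1,2) by (simp add: less_divide_eq)
  with feas show ?thesis by blast
qed

section \<open>Stationary means and the balance of their flows\<close>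

definition mean :: "nat \<Rightarrow> 'r::finite state pmf \<Rightarrow> ('r state \<Rightarrow> real) \<Rightarrow> real" where
  "mean N \<pi> g = (\<Sum>x\<in>states N. pmf \<pi> x * g x)"

lemma mean_nonneg: "(\<And>x. x \<in> states N \<Longrightarrow> 0 \<le> g x) \<Longrightarrow> 0 \<le> mean N \<pi> g"
  by (simp add: mean_def sum_nonneg)

lemma mean_sum: "mean N \<pi> (\<lambda>x. \<Sum>i\<in>A. g i x) = (\<Sum>i\<in>A. mean N \<pi> (g i))"
  unfolding mean_def sum_distrib_left by (rule sum.swap)

lemma mean_cmult: "mean N \<pi> (\<lambda>x. r * g x) = r * mean N \<pi> g"
  by (simp add: mean_def sum_distrib_left mult_ac)

lemma mean_add: "mean N \<pi> (\<lambda>x. g x + h x) = mean N \<pi> g + mean N \<pi> h"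
  by (simp add: mean_def distrib_left sum.distrib)

lemma mean_const:
  assumes "set_pmf \<pi> \<subseteq> states N" shows "mean N \<pi> (\<lambda>x. r) = r"
  using sum_pmf_eq_1[OF finite_states assms] by (simp add: mean_def flip: sum_distrib_right)

text \<open>The drift of a linear function is a linear combination of transition rates, so its mean
  involves only the flows \<open>U\<close>, \<open>V\<close>, \<open>W\<close>. A state-dependent
  \<open>Q\<close> stays inside the mean that defines \<open>V\<close>, jointly with the count
  \<open>F i j\<close>.\<close>

lemma mean_flow:
  fixes lam :: "'r::finite \<Rightarrow> real"
  assumes inv: "invariant (states N) (rate lam mu P Q N) (pmf \<pi>)"
  defines "U \<equiv> \<lambda>i j. mean N \<pi> (\<lambda>(E, F). if E i i > 0 then real N * lam i * P i j else 0)"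
    and "V \<equiv> \<lambda>i j k. mean N \<pi> (\<lambda>(E, F). mu i j * real (F i j) * Q (scaled N E, scaled N F) j k)"
    and "W \<equiv> \<lambda>i j. mean N \<pi> (\<lambda>(E, F). mu i j * real (E i j))"
  shows "U i j = (\<Sum>k\<in>UNIV. V i j k)"
    and "i \<noteq> j \<Longrightarrow> W i j = (\<Sum>k\<in>UNIV. V k i j)"
    and "(\<Sum>k\<in>UNIV. U i k) = (\<Sum>k\<in>UNIV - {i}. W k i) + (\<Sum>k\<in>UNIV. V k i i)"
proof -
  have "(\<Sum>i\<in>UNIV. \<Sum>j\<in>UNIV. U i j * (\<phi> i j - \<epsilon> i i)) +
      (\<Sum>i\<in>UNIV. \<Sum>j\<in>UNIV. \<Sum>k\<in>UNIV. V i j k * (\<epsilon> j k - \<phi> i j)) +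
      (\<Sum>i\<in>UNIV. \<Sum>j\<in>UNIV - {i}. W i j * (\<epsilon> j j - \<epsilon> i j)) = 0" for \<epsilon> \<phi>
  proof -
    let ?h = "linear_obs \<epsilon> \<phi>"
    have drift: "drift lam mu P Q N ?h x =
        (\<Sum>i\<in>UNIV. \<Sum>j\<in>UNIV. (\<phi> i j - \<epsilon> i i) *
          (case x of (E, F) \<Rightarrow> if E i i > 0 then real N * lam i * P i j else 0)) +
        (\<Sum>i\<in>UNIV. \<Sum>j\<in>UNIV. \<Sum>k\<in>UNIV. (\<epsilon> j k - \<phi> i j) *
          (case x of (E, F) \<Rightarrow> mu i j * real (F i j) * Q (scaled N E, scaled N F) j k)) +
        (\<Sum>i\<in>UNIV. \<Sum>j\<in>UNIV - {i}. (\<epsilon> j j - \<epsilon> i j) *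
          (case x of (E, F) \<Rightarrow> mu i j * real (E i j)))" for x
    proof -
      obtain E F where x: "x = (E, F)" by force
      have E: "?h (E, F') = ?h (dec E i j, F') + \<epsilon> i j" if "0 < E i j" for i j F'
        using linear_obs_inc(1)[of \<epsilon> \<phi> "dec E i j" i j] inc_dec[of E i j, OF that] by simp
      have F: "?h (E', F) = ?h (E', dec F i j) + \<phi> i j" if "0 < F i j" for i j E'
        using linear_obs_inc(2)[of \<epsilon> \<phi> _ "dec F i j" i j] inc_dec[of F i j, OF that] by simp
      show ?thesis
        unfolding x drift_def prod.case
      proof (intro arg_cong2[of _ _ _ _ "(+)"] sum.cong refl)
        show "(if E i i > 0 then real N * lam i * P i j else 0) * (?h (dec E i i, inc F i j) - ?h (E, F)) =
            (\<phi> i j - \<epsilon> i i) * (if E i i > 0 then real N * lam i * P i j else 0)" for i j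
          using E[of i i] by simp
        show "mu i j * real (F i j) * Q (scaled N E, scaled N F) j k *
              (?h (inc E j k, dec F i j) - ?h (E, F)) =
            (\<epsilon> j k - \<phi> i j) * (mu i j * real (F i j) * Q (scaled N E, scaled N F) j k)" for i j k
          using F[of i j E] by (cases "F i j = 0") simp_all
        show "mu i j * real (E i j) * (?h (inc (dec E i j) j j, F) - ?h (E, F)) =
            (\<epsilon> j j - \<epsilon> i j) * (mu i j * real (E i j))" for i j
          using E[of i j F] by (cases "E i j = 0") simp_all
      qed
    qed
    have "0 = (\<Sum>x\<in>states N. pmf \<pi> x *
        (\<Sum>y\<in>states N. rate lam mu P Q N x y * (?h y - ?h x)))"
      using invariant_weak[OF inv] by simp
    also have "\<dots> = mean N \<pi> (drift lam mu P Q N ?h)"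
      unfolding mean_def by (simp add: sum_rate_eq_drift)
    also have "\<dots> = (\<Sum>i\<in>UNIV. \<Sum>j\<in>UNIV. (\<phi> i j - \<epsilon> i i) * U i j) +
      (\<Sum>i\<in>UNIV. \<Sum>j\<in>UNIV. \<Sum>k\<in>UNIV. (\<epsilon> j k - \<phi> i j) * V i j k) +
      (\<Sum>i\<in>UNIV. \<Sum>j\<in>UNIV - {i}. (\<epsilon> j j - \<epsilon> i j) * W i j)"
      unfolding drift mean_add mean_sum mean_cmult U_def V_def W_def ..
    finally show ?thesis by (simp add: mult.commute)
  qed
  from net_flow_vanishing[OF this]
  show "U i j = (\<Sum>k\<in>UNIV. V i j k)" "i \<noteq> j \<Longrightarrow> W i j = (\<Sum>k\<in>UNIV. V k i j)"
    "(\<Sum>k\<in>UNIV. U i k) = (\<Sum>k\<in>UNIV - {i}. W k i) + (\<Sum>k\<in>UNIV. V k i i)"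
    by blast+
qed

lemma mean_mono:
  "(\<And>x. x \<in> states N \<Longrightarrow> g x \<le> h x) \<Longrightarrow> mean N \<pi> g \<le> mean N \<pi> h"
  unfolding mean_def by (intro sum_mono mult_left_mono) auto

lemma mean_cong:
  "(\<And>x. x \<in> states N \<Longrightarrow> g x = h x) \<Longrightarrow> mean N \<pi> g = mean N \<pi> h"
  unfolding mean_def by (intro sum.cong) auto

lemma availability_eq_mean:
  assumes "stationary_dist (states N) (rate lam mu P Q N) = \<pi>" "set_pmf \<pi> \<subseteq> states N" "N > 0"
  shows "availability lam mu P Q N i = mean N \<pi> (\<lambda>(E, F). if E i i > 0 then 1 else 0)"
proof -
  let ?A = "{(E, F). E i i > 0} :: 'a state set"
  have "availability lam mu P Q N i = measure_pmf.prob \<pi> ?A"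
    using assms(1,3) by (simp add: availability_def scaled_def zero_less_divide_iff)
  also have "\<dots> = measure_pmf.prob \<pi> (states N \<inter> ?A)"
    using assms(2) by (intro measure_prob_cong_0) (auto simp: set_pmf_iff)
  also have "\<dots> = (\<Sum>x\<in>states N. if x \<in> ?A then pmf \<pi> x else 0)"
    by (simp add: measure_measure_pmf_finite finite_states sum.inter_restrict[OF finite_states])
  also have "\<dots> = mean N \<pi> (\<lambda>(E, F). if E i i > 0 then 1 else 0)"
    unfolding mean_def by (intro sum.cong) auto
  finally show ?thesis .
qed

text \<open>State-dependent routing is replaced by its flow average: \<open>q' j k\<close> is the
  share of the mean full-car arrivals at \<open>j\<close> that is sent on to \<open>k\<close>. The
  scaled means then solve the linear constraints for \<open>q'\<close>. The lemma takes \<pi> as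
  given so that it serves both claims of the theorem.\<close>

lemma availability_less:
  fixes lam :: "'r::finite \<Rightarrow> real"
  assumes pos: "\<And>i. lam i > 0" "\<And>i j. mu i j > 0" "\<And>i j. c i j > 0" and P: "row_stochastic P"
    and opt: "fluid_optimal lam mu c P q e f a"
    and Q: "routing_policy Q" and N: "N > 0"
    and st: "stationary_dist (states N) (rate lam mu P Q N) = \<pi>"
      "is_stationary (states N) (rate lam mu P Q N) \<pi>"
  shows "reward lam P c (availability lam mu P Q N) < reward lam P c a"
proof -
  let ?S = "states N :: 'r state set" and ?R = "rate lam mu P Q N"
  have sub: "set_pmf \<pi> \<subseteq> ?S" and inv: "invariant ?S ?R (pmf \<pi>)"
    using st(2) by (auto simp: is_stationary_iff_invariant[OF finite_states])
  have nn: "0 \<le> ?R x y" if "x \<in> ?S" for x y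
    by (rule rate_nonneg[OF pos(1,2) P Q N that])
  have Q_row: "0 \<le> Q (scaled N E, scaled N F) j k" "(\<Sum>k\<in>UNIV. Q (scaled N E, scaled N F) j k) = 1"
    if "(E, F) \<in> ?S" for E F j k
    using Q scaled_mem_fluid_space[OF that N] by (auto simp: routing_policy_def row_stochastic_def)
  have P_row: "0 \<le> P i j" "(\<Sum>j\<in>UNIV. P i j) = 1" for i j
    using P by (auto simp: row_stochastic_def)
  define A where "A = availability lam mu P Q N"
  have A: "A i = mean N \<pi> (\<lambda>(E, F). if E i i > 0 then 1 else 0)" for i
    unfolding A_def by (rule availability_eq_mean[OF st(1) sub N])
  define mE where "mE i j = mean N \<pi> (\<lambda>(E, F). real (E i j))" for i j
  define mF where "mF i j = mean N \<pi> (\<lambda>(E, F). real (F i j))" for i j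
  define V where "V i j k =
    mean N \<pi> (\<lambda>(E, F). mu i j * real (F i j) * Q (scaled N E, scaled N F) j k)" for i j k
  define g where "g j k = (\<Sum>i\<in>UNIV. V i j k)" for j k
  define d where "d j = (\<Sum>i\<in>UNIV. mu i j * mF i j)" for j
  have mE_nonneg: "0 \<le> mE i j" and mF_nonneg: "0 \<le> mF i j" for i j
    by (auto simp: mE_def mF_def intro!: mean_nonneg)
  have g_nonneg: "0 \<le> g j k" for j k
    unfolding g_def V_def using Q_row(1) pos(2)
    by (intro sum_nonneg mean_nonneg) (auto simp: less_imp_le)
  have V_sum: "(\<Sum>k\<in>UNIV. V i j k) = mu i j * mF i j" for i j
    unfolding V_def mF_def mean_cmult[symmetric] mean_sum[symmetric]
    by (intro mean_cong) (auto simp: Q_row(2) simp flip: sum_distrib_left)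
  have g_sum: "(\<Sum>k\<in>UNIV. g j k) = d j" for j
    unfolding g_def d_def V_sum[symmetric] by (rule sum.swap)
  have U: "mean N \<pi> (\<lambda>(E, F). if E i i > 0 then real N * lam i * P i j else 0) =
      real N * (lam i * P i j * A i)" for i j
  proof -
    have "mean N \<pi> (\<lambda>(E, F). if E i i > 0 then real N * lam i * P i j else 0) =
        mean N \<pi> (\<lambda>x. (real N * lam i * P i j) * (case x of (E, F) \<Rightarrow> if E i i > 0 then 1 else 0))"
      by (intro mean_cong) auto
    then show ?thesis by (simp add: mean_cmult A)
  qed
  have W: "mean N \<pi> (\<lambda>(E, F). mu i j * real (E i j)) = mu i j * mE i j" for i j
    unfolding mE_def mean_cmult[symmetric] by (intro mean_cong) auto
  note flow = mean_flow[OF inv, folded V_def, unfolded U W V_sum, folded g_def]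
  have flow1: "real N * (lam i * P i j * A i) = mu i j * mF i j" for i j
    by (rule flow(1))
  have flow2: "mu i j * mE i j = g i j" if "i \<noteq> j" for i j
    by (rule flow(2)[OF that])
  have flow3: "real N * (lam i * A i) = (\<Sum>k\<in>UNIV - {i}. mu k i * mE k i) + g i i" for i
  proof -
    have "(\<Sum>k\<in>UNIV. real N * (lam i * P i k * A i)) = real N * (lam i * A i) * (\<Sum>k\<in>UNIV. P i k)"
      by (simp add: sum_distrib_left mult_ac)
    then show ?thesis
      using flow(3)[of i] by (simp add: P_row(2))
  qed
  \<comment> \<open>For a region without arrivals the row is a default; the identity row keeps
    \<open>q'\<close> stochastic.\<close>
  define q' where "q' j k = (if d j = 0 then if j = k then 1 else 0 else g j k / d j)" for j k
  have d_nonneg: "0 \<le> d j" for j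
    unfolding g_sum[symmetric] using g_nonneg by (intro sum_nonneg)
  have g_zero: "g j k = 0" if "d j = 0" for j k
    using that g_sum[of j] g_nonneg by (simp add: sum_nonneg_eq_0_iff)
  have q'_d: "q' j k * d j = g j k" for j k
    using g_zero by (simp add: q'_def)
  have q'_row: "row_stochastic q'"
    unfolding row_stochastic_def
  proof (intro conjI allI)
    show "0 \<le> q' i j" for i j
      using g_nonneg d_nonneg by (simp add: q'_def)
    show "(\<Sum>j\<in>UNIV. q' i j) = 1" for i
      by (cases "d i = 0") (simp_all add: q'_def g_sum flip: sum_divide_distrib)
  qed
  have mass: "(\<Sum>i\<in>UNIV. \<Sum>j\<in>UNIV. mE i j + mF i j) = real N"
  proof -
    have "(\<Sum>i\<in>UNIV. \<Sum>j\<in>UNIV. mE i j + mF i j) =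
        mean N \<pi> (\<lambda>x. \<Sum>i\<in>UNIV. \<Sum>j\<in>UNIV. (case x of (E, F) \<Rightarrow> real (E i j)) + (case x of (E, F) \<Rightarrow> real (F i j)))"
      by (simp add: mean_sum mean_add mE_def mF_def)
    also have "\<dots> = mean N \<pi> (\<lambda>_. real N)"
      by (intro mean_cong) (auto simp: states_def)
    finally show ?thesis by (simp add: mean_const[OF sub])
  qed
  have A_nonneg: "0 \<le> A i" for i
    unfolding A by (intro mean_nonneg) auto
  have A_le_mE: "A i \<le> mE i i" for i
    unfolding A mE_def by (intro mean_mono) auto
  have mE_le_A: "mE i i \<le> real N * A i" for i
    unfolding A mE_def mean_cmult[symmetric]
  proof (intro mean_mono, clarify)
    fix E F assume "(E, F) \<in> ?S"
    then have "(\<Sum>i\<in>UNIV. \<Sum>j\<in>UNIV. real (E i j) + real (F i j)) = real N"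
      by (auto simp: states_def)
    then have "real (E i i) \<le> real N"
      using member_le_double_sum[of UNIV "\<lambda>_. UNIV" "\<lambda>i j. real (E i j) + real (F i j)" i i] by simp
    then show "real (E i i) \<le> real N * (if E i i > 0 then 1 else 0)" by simp
  qed
  \<comment> \<open>Without available cars there are no customer trips, hence no full cars, no empty
    cars under way and, by \<open>mE_le_A\<close>, no idle cars, contradicting the total of
    \<open>N\<close>.\<close>
  have "\<exists>k. 0 < A k"
  proof (rule ccontr)
    assume "\<nexists>k. 0 < A k"
    with A_nonneg have A0: "A i = 0" for i by (metis order.order_iff_strict)
    have F0: "mF i j = 0" for i j
      using flow1[of i j] pos(2)[of i j] by (simp add: A0)
    then have "g i j = 0" for i j
      by (intro g_zero) (simp add: d_def)
    then have "mE i j = 0" for i j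
      using flow2[of i j] pos(2)[of i j] mE_le_A[of i] mE_nonneg[of i i] by (cases "i = j") (auto simp: A0)
    with F0 mass N show False by simp
  qed
  then obtain k where k: "0 < A k" ..
  \<comment> \<open>Take a state in the support with the fewest idle cars at \<open>i\<close>. Were
    there any, a departure of positive rate would lead to a state in the support with one fewer.
    Hence the region is empty with positive probability.\<close>
  have A_less: "A i < 1" for i
  proof -
    obtain x0 where "x0 \<in> set_pmf \<pi>"
      using set_pmf_not_empty by fast
    then obtain x where x: "x \<in> set_pmf \<pi>" and min: "\<And>y. y \<in> set_pmf \<pi> \<Longrightarrow> fst x i i \<le> fst y i i"
      using ex_has_least_nat[of "\<lambda>x. x \<in> set_pmf \<pi>" x0 "\<lambda>x. fst x i i"] by blast
    obtain E F where EF: "x = (E, F)" by force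
    with x sub have xS: "(E, F) \<in> ?S" and px: "0 < pmf \<pi> (E, F)" by (auto simp: pmf_positive)
    have E0: "E i i = 0"
    proof (rule ccontr)
      assume "E i i \<noteq> 0"
      then have E: "0 < E i i" by simp
      obtain j where "P i j \<noteq> 0"
        using P_row(2)[of i] by (metis sum.neutral zero_neq_one)
      with P_row(1)[of i j] have "0 < real N * lam i * P i j"
        using N pos(1)[of i] by simp
      also have "\<dots> \<le> ?R (E, F) (dec E i i, inc F i j)"
        by (rule rate_ge(1)[OF pos(1,2) P Q N xS E])
      finally have "0 < pmf \<pi> (dec E i i, inc F i j)"
        using invariant_pos_step[OF finite_states nn _ inv xS px] move_mem_states(1)[OF xS E] by simp
      then have "(dec E i i, inc F i j) \<in> set_pmf \<pi>" by (simp add: set_pmf_iff)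
      from min[OF this] E show False
        by (simp add: EF dec_apply)
    qed
    have "A i + mean N \<pi> (\<lambda>(E, F). if E i i > 0 then 0 else 1) = mean N \<pi> (\<lambda>_. 1)"
      unfolding A mean_add[symmetric] by (intro mean_cong) auto
    moreover have "pmf \<pi> (E, F) * (case (E, F) of (E, F) \<Rightarrow> if E i i > 0 then 0 else 1)
        \<le> mean N \<pi> (\<lambda>(E, F). if E i i > 0 then 0 else 1)"
      unfolding mean_def using xS
      by (intro member_le_sum[where f = "\<lambda>x. pmf \<pi> x * (case x of (E, F) \<Rightarrow> if E i i > 0 then 0 else 1)"])
        (auto simp: finite_states)
    ultimately show ?thesis
      using px by (simp add: mean_const[OF sub] E0)
  qed
  have d_div: "(\<Sum>k\<in>UNIV. mu k i * (mF k i / real N)) = d i / real N" for i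
    by (simp add: d_def sum_divide_distrib)
  have "\<exists>q' e' f' a'. fluid_feasible lam mu P q' e' f' a' \<and> reward lam P c A < reward lam P c a'"
  proof (rule slack_not_optimal[OF pos(1,3) P _ _ _ q'_row])
    show "lam i * P i j * A i = mu i j * (mF i j / real N)" for i j
      using flow1[of i j] N by (simp add: field_simps)
    show "mu i j * (mE i j / real N) = q' i j * (\<Sum>k\<in>UNIV. mu k i * (mF k i / real N))"
      if "i \<noteq> j" for i j
      unfolding d_div using flow2[OF that] q'_d[of i j] by simp
    have "(\<Sum>k\<in>UNIV - {i}. mu k i * (mE k i / real N)) = (\<Sum>k\<in>UNIV - {i}. mu k i * mE k i) / real N" for i
      by (simp add: sum_divide_distrib)
    then show "lam i * A i = (\<Sum>k\<in>UNIV - {i}. mu k i * (mE k i / real N)) +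
        q' i i * (\<Sum>k\<in>UNIV. mu k i * (mF k i / real N))" for i
      unfolding d_div using flow3[of i] q'_d[of i i] N by (simp add: field_simps)
    show "0 \<le> mE i j / real N" "0 \<le> mF i j / real N" for i j
      using mE_nonneg mF_nonneg by simp_all
    show "(\<Sum>i\<in>UNIV. \<Sum>j\<in>UNIV. mE i j / real N + mF i j / real N) = 1"
      using mass N by (simp flip: add_divide_distrib sum_divide_distrib)
    show "0 \<le> A i" "A i < 1" for i by (fact A_nonneg A_less)+
    show "0 < A k" by (fact k)
    show "0 < mE k k / real N" using k A_le_mE[of k] N by simp
  qed
  then show ?thesis
    using opt unfolding fluid_optimal_def A_def by force
qed

section \<open>Product form under a static policy\<close>

text \<open>The product form of a closed queueing network: an idle pool \<open>E i i\<close> is a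
  single-server queue and gives a geometric factor, whereas travelling cars move independently, as
  in an infinite-server queue, and give Poisson factors.\<close>

definition weight ::
  "(('r::finite) \<Rightarrow> real) \<Rightarrow> 'r mat \<Rightarrow> 'r mat \<Rightarrow> 'r state \<Rightarrow> real" where
  "weight a y z x =
     (\<Prod>i\<in>UNIV. \<Prod>j\<in>UNIV. if i = j then a i ^ fst x i j else y i j ^ fst x i j / fact (fst x i j)) *
     (\<Prod>i\<in>UNIV. \<Prod>j\<in>UNIV. z i j ^ snd x i j / fact (snd x i j))"

definition partition_sum :: "(('r::finite) \<Rightarrow> real) \<Rightarrow> 'r mat \<Rightarrow> 'r mat \<Rightarrow> nat \<Rightarrow> real" where
  "partition_sum a y z M = (\<Sum>x\<in>(states M :: 'r state set). weight a y z x)"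

lemma weight_nonneg:
  assumes "\<And>i. 0 \<le> a i" "\<And>i j. 0 \<le> y i j" "\<And>i j. 0 \<le> z i j"
  shows "0 \<le> weight a y z x"
  unfolding weight_def using assms by (intro mult_nonneg_nonneg prod_nonneg ballI) auto

text \<open>Only the factor at \<open>(k, l)\<close> changes. Its ratio is given by \<open>s\<close>
  and \<open>t\<close> to avoid division: \<open>s\<close> is the new count for a Poisson factor and
  1 for a geometric one. The untouched half of the weight is \<open>b\<close>.\<close>

lemma prod_inc:
  fixes \<phi> :: "'r::finite \<Rightarrow> 'r \<Rightarrow> nat \<Rightarrow> real"
  assumes "\<phi> k l (Suc (M k l)) * s = t * \<phi> k l (M k l)"
  shows "(\<Prod>i\<in>UNIV. \<Prod>j\<in>UNIV. \<phi> i j (inc M k l i j)) * b * s =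
           t * ((\<Prod>i\<in>UNIV. \<Prod>j\<in>UNIV. \<phi> i j (M i j)) * b)"
proof -
  have split: "(\<Prod>i\<in>UNIV. \<Prod>j\<in>UNIV. \<phi> i j (M' i j)) =
      \<phi> k l (M' k l) * (\<Prod>p\<in>UNIV - {(k, l)}. \<phi> (fst p) (snd p) (M' (fst p) (snd p)))" for M'
    using prod.remove[of UNIV "(k, l)" "\<lambda>p. \<phi> (fst p) (snd p) (M' (fst p) (snd p))"]
    by (simp add: prod.cartesian_product case_prod_beta)
  have "(\<Prod>p\<in>UNIV - {(k, l)}. \<phi> (fst p) (snd p) (inc M k l (fst p) (snd p))) =
      (\<Prod>p\<in>UNIV - {(k, l)}. \<phi> (fst p) (snd p) (M (fst p) (snd p)))"
    by (intro prod.cong refl) (auto simp: inc_apply)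
  then have "(\<Prod>i\<in>UNIV. \<Prod>j\<in>UNIV. \<phi> i j (inc M k l i j)) * b * s =
      \<phi> k l (Suc (M k l)) * s *
        (b * (\<Prod>p\<in>UNIV - {(k, l)}. \<phi> (fst p) (snd p) (M (fst p) (snd p))))"
    by (simp add: split inc_apply mult_ac)
  then show ?thesis
    unfolding assms by (simp add: split mult_ac)
qed

lemma weight_inc_diag: "weight a y z (inc E i i, F) = a i * weight a y z (E, F)"
proof -
  have "weight a y z (inc E i i, F) * 1 = a i * weight a y z (E, F)"
    unfolding weight_def fst_conv snd_conv
    by (rule prod_inc[where \<phi> = "\<lambda>i j n. if i = j then a i ^ n else y i j ^ n / fact n"]) simp
  then show ?thesis by simp
qed

lemma weight_inc_fst:
  "i \<noteq> j \<Longrightarrow> weight a y z (inc E i j, F) * real (Suc (E i j)) = y i j * weight a y z (E, F)"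
  unfolding weight_def fst_conv snd_conv
  by (rule prod_inc[where \<phi> = "\<lambda>i j n. if i = j then a i ^ n else y i j ^ n / fact n"])
    (simp add: field_simps del: of_nat_Suc)

lemma weight_inc_snd:
  "weight a y z (E, inc F i j) * real (Suc (F i j)) = z i j * weight a y z (E, F)"
  unfolding weight_def fst_conv snd_conv
  by (subst (1 2) mult.commute, rule prod_inc[where \<phi> = "\<lambda>i j n. z i j ^ n / fact n"]) (simp add: field_simps del: of_nat_Suc)

text \<open>Taking away one car of the given kind is a bijection onto the states with
  \<open>M\<close> cars.\<close>

lemma sum_states_inc_fst:
  fixes \<psi> :: "'r::finite state \<Rightarrow> real"
  shows "(\<Sum>x\<in>states (Suc M). if 0 < fst x i j then \<psi> x else 0) =
         (\<Sum>x\<in>states M. \<psi> (inc (fst x) i j, snd x))"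
proof -
  have "(\<Sum>x\<in>states (Suc M). if 0 < fst x i j then \<psi> x else 0) =
      (\<Sum>x\<in>{x \<in> states (Suc M). 0 < fst x i j}. \<psi> x)"
    by (intro sum.mono_neutral_cong_right) (auto simp: finite_states)
  also have "\<dots> = (\<Sum>x\<in>states M. \<psi> (inc (fst x) i j, snd x))"
  proof (rule sum.reindex_bij_witness[of _ "\<lambda>x. (inc (fst x) i j, snd x)" "\<lambda>x. (dec (fst x) i j, snd x)"])
    fix x :: "'r state" assume x: "x \<in> {x \<in> states (Suc M). 0 < fst x i j}"
    then have eq: "inc (dec (fst x) i j) i j = fst x" by (simp add: inc_dec)
    with x show "(dec (fst x) i j, snd x) \<in> states M"
      using inc_mem_states(1)[of "dec (fst x) i j" i j "snd x" M] by simp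
    from eq show "(inc (fst (dec (fst x) i j, snd x)) i j, snd (dec (fst x) i j, snd x)) = x" by simp
    then show "\<psi> (inc (fst (dec (fst x) i j, snd x)) i j, snd (dec (fst x) i j, snd x)) = \<psi> x" by simp
  qed (auto simp: inc_apply)
  finally show ?thesis .
qed

lemma sum_states_inc_snd:
  fixes \<psi> :: "'r::finite state \<Rightarrow> real"
  shows "(\<Sum>x\<in>states (Suc M). if 0 < snd x i j then \<psi> x else 0) =
         (\<Sum>x\<in>states M. \<psi> (fst x, inc (snd x) i j))"
proof -
  have "(\<Sum>x\<in>states (Suc M). if 0 < snd x i j then \<psi> x else 0) =
      (\<Sum>x\<in>{x \<in> states (Suc M). 0 < snd x i j}. \<psi> x)"
    by (intro sum.mono_neutral_cong_right) (auto simp: finite_states)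
  also have "\<dots> = (\<Sum>x\<in>states M. \<psi> (fst x, inc (snd x) i j))"
  proof (rule sum.reindex_bij_witness[of _ "\<lambda>x. (fst x, inc (snd x) i j)" "\<lambda>x. (fst x, dec (snd x) i j)"])
    fix x :: "'r state" assume x: "x \<in> {x \<in> states (Suc M). 0 < snd x i j}"
    then have eq: "inc (dec (snd x) i j) i j = snd x" by (simp add: inc_dec)
    with x show "(fst x, dec (snd x) i j) \<in> states M"
      using inc_mem_states(2)[of "fst x" "dec (snd x) i j" i j M] by simp
    from eq show "(fst (fst x, dec (snd x) i j), inc (snd (fst x, dec (snd x) i j)) i j) = x" by simp
    then show "\<psi> (fst (fst x, dec (snd x) i j), inc (snd (fst x, dec (snd x) i j)) i j) = \<psi> x" by simp
  qed (auto simp: inc_apply)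
  finally show ?thesis .
qed

text \<open>When one car is removed, the change of weight is cancelled by exactly the factor that
  drives its transitions: the indicator of a nonempty pool here, the count for travelling cars in
  the next two lemmas. Only the load of the removed car remains.\<close>

lemma sum_weight_diag:
  fixes \<psi> :: "'r::finite state \<Rightarrow> real"
  shows "(\<Sum>x\<in>states (Suc M). weight a y z x * (if 0 < fst x i i then \<psi> x else 0)) =
         (\<Sum>x\<in>states M. weight a y z x * (a i * \<psi> (inc (fst x) i i, snd x)))"
proof -
  have "(\<Sum>x\<in>states (Suc M). weight a y z x * (if 0 < fst x i i then \<psi> x else 0)) =
      (\<Sum>x\<in>states (Suc M). if 0 < fst x i i then weight a y z x * \<psi> x else 0)"
    by (intro sum.cong) auto
  also have "\<dots> = (\<Sum>x\<in>states M. weight a y z x * (a i * \<psi> (inc (fst x) i i, snd x)))"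
    unfolding sum_states_inc_fst by (intro sum.cong refl) (simp add: weight_inc_diag)
  finally show ?thesis .
qed

lemma sum_weight_fst:
  fixes \<psi> :: "'r::finite state \<Rightarrow> real"
  assumes "i \<noteq> j"
  shows "(\<Sum>x\<in>states (Suc M). weight a y z x * (real (fst x i j) * \<psi> x)) =
         (\<Sum>x\<in>states M. weight a y z x * (y i j * \<psi> (inc (fst x) i j, snd x)))"
proof -
  have "(\<Sum>x\<in>states (Suc M). weight a y z x * (real (fst x i j) * \<psi> x)) =
      (\<Sum>x\<in>states (Suc M). if 0 < fst x i j then weight a y z x * real (fst x i j) * \<psi> x else 0)"
    by (intro sum.cong) auto
  also have "\<dots> = (\<Sum>x\<in>states M. weight a y z x * (y i j * \<psi> (inc (fst x) i j, snd x)))"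
    unfolding sum_states_inc_fst
    by (intro sum.cong refl)
      (use weight_inc_fst[OF assms, of a y z] in \<open>simp add: inc_apply add.commute mult_ac\<close>)
  finally show ?thesis .
qed

lemma sum_weight_snd:
  fixes \<psi> :: "'r::finite state \<Rightarrow> real"
  shows "(\<Sum>x\<in>states (Suc M). weight a y z x * (real (snd x i j) * \<psi> x)) =
         (\<Sum>x\<in>states M. weight a y z x * (z i j * \<psi> (fst x, inc (snd x) i j)))"
proof -
  have "(\<Sum>x\<in>states (Suc M). weight a y z x * (real (snd x i j) * \<psi> x)) =
      (\<Sum>x\<in>states (Suc M). if 0 < snd x i j then weight a y z x * real (snd x i j) * \<psi> x else 0)"
    by (intro sum.cong) auto
  also have "\<dots> = (\<Sum>x\<in>states M. weight a y z x * (z i j * \<psi> (fst x, inc (snd x) i j)))"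
    unfolding sum_states_inc_snd
    by (intro sum.cong refl)
      (use weight_inc_snd[of a y z] in \<open>simp add: inc_apply add.commute mult_ac\<close>)
  finally show ?thesis .
qed

text \<open>Removing one car maps each transition between states of \<open>N\<close> cars to a move of that car over a
  fixed state of \<open>N - 1\<close> cars, where the traffic equations make the net flow vanish.\<close>

lemma weight_invariant:
  fixes lam :: "'r::finite \<Rightarrow> real"
  assumes N: "N > 0" and P: "row_stochastic P" and q: "row_stochastic q"
    and flow: "\<And>i j. real N * lam i * P i j * a i = mu i j * z i j"
      "\<And>i j. i \<noteq> j \<Longrightarrow> mu i j * y i j = q i j * (\<Sum>k\<in>UNIV. mu k i * z k i)"
      "\<And>i. real N * lam i * a i =
        (\<Sum>k\<in>UNIV - {i}. mu k i * y k i) + q i i * (\<Sum>k\<in>UNIV. mu k i * z k i)"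
  shows "invariant (states N) (rate lam mu P (\<lambda>_. q) N) (weight a y z)"
proof (rule invariantI_weak[OF finite_states])
  fix h :: "'r state \<Rightarrow> real"
  obtain M where M: "N = Suc M"
    using N by (cases N) auto
  let ?w = "weight a y z"
  \<comment> \<open>For a state \<open>s\<close> of \<open>N - 1\<close> cars these are the values
    of \<open>h\<close> after the missing car is put back as an empty or as a full one.\<close>
  define \<epsilon> where "\<epsilon> s i j = h (inc (fst s) i j, snd s)" for s i j
  define \<phi> where "\<phi> s i j = h (fst s, inc (snd s) i j)" for s i j
  let ?U = "\<lambda>i j. real N * lam i * P i j * a i"
  let ?V = "\<lambda>i j k. mu i j * z i j * q j k"
  let ?W = "\<lambda>i j. mu i j * y i j"
  \<comment> \<open>With \<open>s\<close> fixed, \<open>\<epsilon> s\<close> and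
    \<open>\<phi> s\<close> are mere coefficients, so \<open>net_flow\<close> applies although
    \<open>h\<close> is not linear.\<close>
  have net: "(\<Sum>i\<in>UNIV. \<Sum>j\<in>UNIV. ?U i j * (\<phi> s i j - \<epsilon> s i i)) +
      (\<Sum>i\<in>UNIV. \<Sum>j\<in>UNIV. \<Sum>k\<in>UNIV. ?V i j k * (\<epsilon> s j k - \<phi> s i j)) +
      (\<Sum>i\<in>UNIV. \<Sum>j\<in>UNIV - {i}. ?W i j * (\<epsilon> s j j - \<epsilon> s i j)) = 0" for s
  proof -
    have V1: "(\<Sum>k\<in>UNIV. ?V i j k) = mu i j * z i j" for i j
      using q by (simp add: row_stochastic_def flip: sum_distrib_left)
    have V2: "(\<Sum>k\<in>UNIV. ?V k i j) = q i j * (\<Sum>k\<in>UNIV. mu k i * z k i)" for i j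
      by (simp add: sum_distrib_left mult_ac)
    have "(\<Sum>k\<in>UNIV. ?U i k) = real N * lam i * a i * (\<Sum>k\<in>UNIV. P i k)" for i
      by (simp add: sum_distrib_left mult_ac)
    then have U: "(\<Sum>k\<in>UNIV. ?U i k) = real N * lam i * a i" for i
      using P by (simp add: row_stochastic_def)
    have inflow: "(\<Sum>k\<in>UNIV. ?V k i j) +
        (if i = j then (\<Sum>k\<in>UNIV - {i}. ?W k i) - (\<Sum>k\<in>UNIV. ?U i k) else - ?W i j) = 0" for i j
      unfolding V2 U using flow(2)[of i j] flow(3)[of i] by (cases "i = j") simp_all
    have outflow: "?U i j - (\<Sum>k\<in>UNIV. ?V i j k) = 0" for i j
      unfolding V1 flow(1) by simp
    show ?thesis
      unfolding net_flow[where U = ?U and V = ?V and W = ?W and \<phi> = "\<phi> s" and \<epsilon> = "\<epsilon> s"]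
        inflow outflow by simp
  qed
  have "(\<Sum>x\<in>states N. ?w x * (\<Sum>y\<in>states N. rate lam mu P (\<lambda>_. q) N x y * (h y - h x))) =
      (\<Sum>x\<in>states N. ?w x * drift lam mu P (\<lambda>_. q) N h x)"
    by (simp add: sum_rate_eq_drift)
  also have "\<dots> = (\<Sum>i\<in>UNIV. \<Sum>j\<in>UNIV. \<Sum>x\<in>states N. ?w x *
        ((if fst x i i > 0 then real N * lam i * P i j else 0) *
        (h (dec (fst x) i i, inc (snd x) i j) - h x))) +
      (\<Sum>i\<in>UNIV. \<Sum>j\<in>UNIV. \<Sum>k\<in>UNIV. \<Sum>x\<in>states N. ?w x * (mu i j * real (snd x i j) * q j k *
        (h (inc (fst x) j k, dec (snd x) i j) - h x))) +
      (\<Sum>i\<in>UNIV. \<Sum>j\<in>UNIV - {i}. \<Sum>x\<in>states N. ?w x * (mu i j * real (fst x i j) *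
        (h (inc (dec (fst x) i j) j j, snd x) - h x)))"
    (is "_ = ?A + ?B + ?C")
    unfolding drift_def case_prod_beta distrib_left sum.distrib sum_mult_double_sum prod.collapse
    unfolding sum_distrib_left[of _ _ UNIV] sum.swap[of _ UNIV "states N"] ..
  also have "?A = (\<Sum>i\<in>UNIV. \<Sum>j\<in>UNIV. \<Sum>s\<in>states M. ?w s * (?U i j * (\<phi> s i j - \<epsilon> s i i)))"
  proof (intro sum.cong[OF refl])
    fix i j
    have "(\<Sum>x\<in>states N. ?w x * ((if fst x i i > 0 then real N * lam i * P i j else 0) *
          (h (dec (fst x) i i, inc (snd x) i j) - h x))) =
        (\<Sum>x\<in>states (Suc M). ?w x * (if 0 < fst x i i then real N * lam i * P i j *
          (h (dec (fst x) i i, inc (snd x) i j) - h x) else 0))"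
      unfolding M by (intro sum.cong) auto
    also have "\<dots> = (\<Sum>s\<in>states M. ?w s * (?U i j * (\<phi> s i j - \<epsilon> s i i)))"
      unfolding sum_weight_diag by (simp add: \<epsilon>_def \<phi>_def mult_ac)
    finally show "(\<Sum>x\<in>states N. ?w x * ((if fst x i i > 0 then real N * lam i * P i j else 0) *
          (h (dec (fst x) i i, inc (snd x) i j) - h x))) = \<dots>" .
  qed
  also have "?B = (\<Sum>i\<in>UNIV. \<Sum>j\<in>UNIV. \<Sum>k\<in>UNIV. \<Sum>s\<in>states M. ?w s * (?V i j k * (\<epsilon> s j k - \<phi> s i j)))"
  proof (intro sum.cong[OF refl])
    fix i j k
    have "(\<Sum>x\<in>states N. ?w x * (mu i j * real (snd x i j) * q j k *
          (h (inc (fst x) j k, dec (snd x) i j) - h x))) =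
        (\<Sum>x\<in>states (Suc M). ?w x * (real (snd x i j) * (mu i j * q j k *
          (h (inc (fst x) j k, dec (snd x) i j) - h x))))"
      unfolding M by (intro sum.cong) auto
    also have "\<dots> = (\<Sum>s\<in>states M. ?w s * (?V i j k * (\<epsilon> s j k - \<phi> s i j)))"
      unfolding sum_weight_snd by (simp add: \<epsilon>_def \<phi>_def mult_ac)
    finally show "(\<Sum>x\<in>states N. ?w x * (mu i j * real (snd x i j) * q j k *
          (h (inc (fst x) j k, dec (snd x) i j) - h x))) = \<dots>" .
  qed
  also have "?C = (\<Sum>i\<in>UNIV. \<Sum>j\<in>UNIV - {i}. \<Sum>s\<in>states M. ?w s * (?W i j * (\<epsilon> s j j - \<epsilon> s i j)))"
  proof (intro sum.cong[OF refl])
    fix i j :: 'r assume "j \<in> UNIV - {i}"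
    then have ij: "i \<noteq> j" by simp
    have "(\<Sum>x\<in>states N. ?w x * (mu i j * real (fst x i j) *
          (h (inc (dec (fst x) i j) j j, snd x) - h x))) =
        (\<Sum>x\<in>states (Suc M). ?w x * (real (fst x i j) * (mu i j *
          (h (inc (dec (fst x) i j) j j, snd x) - h x))))"
      unfolding M by (intro sum.cong) auto
    also have "\<dots> = (\<Sum>s\<in>states M. ?w s * (?W i j * (\<epsilon> s j j - \<epsilon> s i j)))"
      unfolding sum_weight_fst[OF ij] by (simp add: \<epsilon>_def \<phi>_def mult_ac)
    finally show "(\<Sum>x\<in>states N. ?w x * (mu i j * real (fst x i j) *
          (h (inc (dec (fst x) i j) j j, snd x) - h x))) = \<dots>" .
  qed
  also have "(\<Sum>i\<in>UNIV. \<Sum>j\<in>UNIV. \<Sum>s\<in>states M. ?w s * (?U i j * (\<phi> s i j - \<epsilon> s i i))) +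
      (\<Sum>i\<in>UNIV. \<Sum>j\<in>UNIV. \<Sum>k\<in>UNIV. \<Sum>s\<in>states M. ?w s * (?V i j k * (\<epsilon> s j k - \<phi> s i j))) +
      (\<Sum>i\<in>UNIV. \<Sum>j\<in>UNIV - {i}. \<Sum>s\<in>states M. ?w s * (?W i j * (\<epsilon> s j j - \<epsilon> s i j))) =
    (\<Sum>s\<in>states M. ?w s * ((\<Sum>i\<in>UNIV. \<Sum>j\<in>UNIV. ?U i j * (\<phi> s i j - \<epsilon> s i i)) +
      (\<Sum>i\<in>UNIV. \<Sum>j\<in>UNIV. \<Sum>k\<in>UNIV. ?V i j k * (\<epsilon> s j k - \<phi> s i j)) +
      (\<Sum>i\<in>UNIV. \<Sum>j\<in>UNIV - {i}. ?W i j * (\<epsilon> s j j - \<epsilon> s i j))))"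
    unfolding distrib_left sum.distrib sum_mult_double_sum
    unfolding sum_distrib_left[of _ _ UNIV] sum.swap[of _ UNIV "states M"] ..
  also have "\<dots> = 0"
    unfolding net by simp
  finally show "(\<Sum>x\<in>states N. ?w x * (\<Sum>y\<in>states N. rate lam mu P (\<lambda>_. q) N x y * (h y - h x))) = 0" .
qed

section \<open>Recursions for the normalizing constants and the idle cars\<close>

definition idle_sum :: "(('r::finite) \<Rightarrow> real) \<Rightarrow> 'r mat \<Rightarrow> 'r mat \<Rightarrow> nat \<Rightarrow> real" where
  "idle_sum a y z M =
     (\<Sum>i\<in>UNIV. \<Sum>x\<in>(states M :: 'r state set). weight a y z x * real (fst x i i))"

text \<open>After one idle car at \<open>i\<close> is removed, the old count is 1 plus the count
  among the remaining \<open>M\<close> cars. This is the arrival theorem for closed networks in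
  unnormalized form.\<close>

lemma idle_sum_Suc:
  "idle_sum a y z (Suc M) =
     (\<Sum>i\<in>UNIV. a i * (partition_sum a y z M + (\<Sum>x\<in>states M. weight a y z x * real (fst x i i))))"
proof -
  have "(\<Sum>x\<in>states (Suc M). weight a y z x * real (fst x i i)) =
      (\<Sum>x\<in>states (Suc M). weight a y z x * (if 0 < fst x i i then real (fst x i i) else 0))" for i
    by (intro sum.cong) auto
  then show ?thesis
    unfolding idle_sum_def partition_sum_def sum_weight_diag
    by (simp add: inc_apply sum_distrib_left distrib_left mult_ac flip: sum.distrib)
qed

text \<open>Write \<open>Suc M\<close> as the sum of all entries of the state. Each class of
  travelling cars contributes its load times the constant for \<open>M\<close> cars; the idle pools
  are kept together in \<open>idle_sum\<close>.\<close>

lemma partition_sum_Suc: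
  "real (Suc M) * partition_sum a y z (Suc M) =
     ((\<Sum>i\<in>UNIV. \<Sum>j\<in>UNIV - {i}. y i j) + (\<Sum>i\<in>UNIV. \<Sum>j\<in>UNIV. z i j)) * partition_sum a y z M +
     idle_sum a y z (Suc M)"
proof -
  let ?w = "weight a y z"
  have "real (Suc M) * partition_sum a y z (Suc M) =
      (\<Sum>x\<in>states (Suc M). ?w x * ((\<Sum>i\<in>UNIV. \<Sum>j\<in>UNIV. real (fst x i j)) + (\<Sum>i\<in>UNIV. \<Sum>j\<in>UNIV. real (snd x i j))))"
    unfolding partition_sum_def sum_distrib_left
  proof (intro sum.cong refl)
    fix x :: "'a state" assume "x \<in> states (Suc M)"
    then have "(\<Sum>i\<in>UNIV. \<Sum>j\<in>UNIV. fst x i j + snd x i j) = Suc M"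
      by (auto simp: states_def)
    then have "real (\<Sum>i\<in>UNIV. \<Sum>j\<in>UNIV. fst x i j + snd x i j) = real (Suc M)"
      by (rule arg_cong)
    then show "real (Suc M) * ?w x =
        ?w x * ((\<Sum>i\<in>UNIV. \<Sum>j\<in>UNIV. real (fst x i j)) + (\<Sum>i\<in>UNIV. \<Sum>j\<in>UNIV. real (snd x i j)))"
      by (simp add: sum.distrib)
  qed
  also have "\<dots> = (\<Sum>x\<in>states (Suc M). ?w x * (\<Sum>i\<in>UNIV. real (fst x i i))) +
      (\<Sum>i\<in>UNIV. \<Sum>j\<in>UNIV - {i}. \<Sum>x\<in>states (Suc M). ?w x * (real (fst x i j) * 1)) +
      (\<Sum>i\<in>UNIV. \<Sum>j\<in>UNIV. \<Sum>x\<in>states (Suc M). ?w x * (real (snd x i j) * 1))"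
    unfolding sum_off_diagonal[of "\<lambda>i j. real (fst _ i j)"] distrib_left sum.distrib sum_mult_double_sum
    by simp
  also have "(\<Sum>x\<in>states (Suc M). ?w x * (\<Sum>i\<in>UNIV. real (fst x i i))) = idle_sum a y z (Suc M)"
    unfolding idle_sum_def sum_distrib_left by (rule sum.swap)
  also have "(\<Sum>i\<in>UNIV. \<Sum>j\<in>UNIV - {i}. \<Sum>x\<in>states (Suc M). ?w x * (real (fst x i j) * 1)) =
      (\<Sum>i\<in>UNIV. \<Sum>j\<in>UNIV - {i}. y i j * partition_sum a y z M)"
    by (intro sum.cong refl, subst sum_weight_fst)
      (auto simp: partition_sum_def sum_distrib_left mult.commute)
  also have "(\<Sum>i\<in>UNIV. \<Sum>j\<in>UNIV. \<Sum>x\<in>states (Suc M). ?w x * (real (snd x i j) * 1)) =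
      (\<Sum>i\<in>UNIV. \<Sum>j\<in>UNIV. z i j * partition_sum a y z M)"
    unfolding sum_weight_snd by (simp add: partition_sum_def sum_distrib_left mult.commute)
  finally show ?thesis
    by (simp add: sum_distrib_right distrib_right)
qed

lemma states_0: "states 0 = {(\<lambda>_ _. 0, \<lambda>_ _. 0)}"
  by (auto simp: states_def fun_eq_iff)

text \<open>The recursion passes positivity on, because the idle term is at least the sum of the
  \<open>a i\<close> times the previous constant. It starts at the empty state, whose weight is 1
  even for vanishing loads, as \<open>0 ^ 0 = 1\<close>.\<close>

lemma partition_sum_pos:
  fixes a :: "'r::finite \<Rightarrow> real"
  assumes nonneg: "\<And>i. 0 \<le> a i" "\<And>i j. 0 \<le> y i j" "\<And>i j. 0 \<le> z i j"
    and pos: "0 < (\<Sum>i\<in>UNIV. \<Sum>j\<in>UNIV - {i}. y i j) + (\<Sum>i\<in>UNIV. \<Sum>j\<in>UNIV. z i j) + (\<Sum>i\<in>UNIV. a i)"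
  shows "0 < partition_sum a y z M"
proof (induction M)
  case 0
  have "weight a y z (\<lambda>_ _. 0, \<lambda>_ _. 0) = 1"
    unfolding weight_def fst_conv snd_conv by (simp cong: if_cong)
  then show ?case
    by (simp add: partition_sum_def states_0)
next
  case (Suc M)
  let ?Y = "(\<Sum>i\<in>UNIV. \<Sum>j\<in>UNIV - {i}. y i j) + (\<Sum>i\<in>UNIV. \<Sum>j\<in>UNIV. z i j)"
  have "(\<Sum>i\<in>UNIV. a i * partition_sum a y z M) \<le> idle_sum a y z (Suc M)"
    unfolding idle_sum_Suc using nonneg weight_nonneg[of a y z]
    by (intro sum_mono mult_left_mono) (auto intro!: sum_nonneg)
  then have "(?Y + (\<Sum>i\<in>UNIV. a i)) * partition_sum a y z M \<le> real (Suc M) * partition_sum a y z (Suc M)"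
    unfolding partition_sum_Suc by (simp add: distrib_right sum_distrib_right)
  moreover have "0 < (?Y + (\<Sum>i\<in>UNIV. a i)) * partition_sum a y z M"
    using pos Suc.IH by simp
  ultimately have "0 < real (Suc M) * partition_sum a y z (Suc M)"
    by linarith
  then show ?case
    by (rule zero_less_mult_pos) simp
qed

lemma idle_sum_Suc_le:
  fixes a :: "'r::finite \<Rightarrow> real"
  assumes nonneg: "\<And>i. 0 \<le> a i" "\<And>i j. 0 \<le> y i j" "\<And>i j. 0 \<le> z i j" and le1: "\<And>i. a i \<le> 1"
  shows "idle_sum a y z (Suc M) \<le> real CARD('r) * partition_sum a y z M + idle_sum a y z M"
proof -
  have "idle_sum a y z (Suc M) \<le>
      (\<Sum>i\<in>UNIV. 1 * (partition_sum a y z M + (\<Sum>x\<in>states M. weight a y z x * real (fst x i i))))"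
    unfolding idle_sum_Suc partition_sum_def using le1 weight_nonneg[of a y z, OF nonneg]
    by (intro sum_mono mult_right_mono) (auto intro!: sum_nonneg add_nonneg_nonneg)
  then show ?thesis
    by (simp add: idle_sum_def sum.distrib)
qed

text \<open>With \<open>D\<close> of order \<open>sqrt (r N)\<close>, the case \<open>M = N - 1\<close> says \<open>g N \<le> (1 + o(1)) g (N - 1)\<close>.\<close>

lemma partition_ratio_bound:
  fixes g T :: "nat \<Rightarrow> real"
  assumes rec: "\<And>M. real (Suc M) * g (Suc M) = L * g M + T (Suc M)"
    and T: "\<And>M. T (Suc M) \<le> r * g M + T M" "T 0 = 0"
    and g: "\<And>M. 0 < g M"
    and L: "0 \<le> L" "L \<le> real N"
    and D: "0 < D" "0 \<le> r" "r * (real N + D) \<le> D * D"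
  shows "Suc M \<le> N \<Longrightarrow> real (Suc M) * g (Suc M) \<le> (real N + D) * g M"
proof (induction M)
  case 0
  have "r \<le> D"
  proof (rule ccontr)
    assume "\<not> r \<le> D"
    then have "D * D < r * (real N + D)"
      using D mult_strict_right_mono[of D r D] mult_left_mono[of D "real N + D" r] by linarith
    with D(3) show False by simp
  qed
  have "real (Suc 0) * g (Suc 0) \<le> L * g 0 + r * g 0"
    using rec[of 0] T(1)[of 0] T(2) by simp
  also have "\<dots> \<le> (real N + D) * g 0"
    unfolding distrib_right using L \<open>r \<le> D\<close> g[of 0] by (intro add_mono mult_right_mono) auto
  finally show ?case .
next
  case (Suc M)
  define G where "G = g (Suc M)"
  define K where "K = real (Suc M)"
  have K: "0 \<le> K" "K \<le> real N" and G: "0 < G"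
    using Suc.prems g by (auto simp: K_def G_def)
  have IH: "K * G \<le> (real N + D) * g M"
    using Suc unfolding K_def G_def by simp
  have ND: "0 < real N + D" using D by simp
  have "real (Suc (Suc M)) * g (Suc (Suc M)) \<le> L * G + r * G + T (Suc M)"
    using rec[of "Suc M"] T(1)[of "Suc M"] by (simp add: G_def)
  \<comment> \<open>\<open>rec\<close> at \<open>M\<close> expresses the idle term by
    \<open>G\<close> and \<open>g M\<close>; this eliminates \<open>T\<close> and creates a
    difference that the induction hypothesis controls.\<close>
  also have "\<dots> = L * (G - g M) + r * G + K * G"
    using rec[of M] by (simp add: G_def K_def algebra_simps)
  \<comment> \<open>The hypothesis bounds \<open>g M\<close> below by a multiple of
    \<open>G\<close>. The resulting bracket is nonnegative because \<open>K \<le> N\<close>, so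
    \<open>L\<close> may then be raised to \<open>N\<close>.\<close>
  also have "L * (G - g M) \<le> real N * (G - K * G / (real N + D))"
  proof -
    have "K * G / (real N + D) \<le> g M"
      using IH ND by (simp add: divide_le_eq mult.commute)
    then have "L * (G - g M) \<le> L * (G - K * G / (real N + D))"
      using L by (intro mult_left_mono) auto
    also have "K * G / (real N + D) \<le> G"
      using K D G ND by (simp add: divide_le_eq mult.commute mult_left_mono)
    then have "L * (G - K * G / (real N + D)) \<le> real N * (G - K * G / (real N + D))"
      using L by (intro mult_right_mono) auto
    finally show ?thesis .
  qed
  also have "real N * (G - K * G / (real N + D)) + r * G + K * G =
      (real N + r + K * D / (real N + D)) * G"
    using ND by (simp add: field_simps)
  also have "\<dots> \<le> (real N + D) * G"
  proof (rule mult_right_mono)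
    \<comment> \<open>The quadratic condition on \<open>D\<close> pays for the new idle cars, and
      \<open>K \<le> N\<close> pays for the rest.\<close>
    have "r * (real N + D) + K * D \<le> D * D + real N * D"
      using D K by (intro add_mono mult_right_mono) auto
    then have "(r * (real N + D) + K * D) / (real N + D) \<le> D"
      using ND by (simp add: divide_le_eq algebra_simps)
    moreover have "(r * (real N + D) + K * D) / (real N + D) = r + K * D / (real N + D)"
      using ND by (simp add: add_divide_distrib)
    ultimately show "real N + r + K * D / (real N + D) \<le> real N + D" by simp
  qed (use G in simp)
  finally show ?case by (simp add: G_def)
qed

section \<open>Accessibility and availabilities under a static policy\<close>

text \<open>All cars can be gathered as idle cars at one region \<open>k\<close>: positive
  \<open>q j j\<close> lets a full car stay where it arrives, and positive \<open>P i k\<close> lets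
  customers drive the idle cars from \<open>i\<close> to \<open>k\<close>.\<close>

lemma static_hub:
  fixes lam :: "'r::finite \<Rightarrow> real"
  assumes pos: "\<And>i. lam i > 0" "\<And>i j. mu i j > 0" and P: "row_stochastic P" "\<And>i j. P i j > 0"
    and q: "row_stochastic q" "\<And>i. q i i > 0" and N: "N > 0"
  shows "\<exists>c\<in>states N. \<forall>x\<in>states N. accessible (states N) (rate lam mu P (\<lambda>_. q) N) x c"
proof -
  let ?S = "states N :: 'r state set" and ?R = "rate lam mu P (\<lambda>_. q) N"
  obtain k :: 'r where True by simp
  define c :: "'r state" where "c = ((\<lambda>i j. if i = k \<and> j = k then N else 0), \<lambda>_ _. 0)"
  text \<open>Bounds the number of steps after which every car is at \<open>k\<close>.\<close>
  define pot :: "'r state \<Rightarrow> nat" where "pot =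
    linear_obs (\<lambda>i j. if i = j then if i = k then 0 else 2 else 3) (\<lambda>i j. if j = k then 1 else 3)"
  have Q: "routing_policy (\<lambda>_. q)"
    using q(1) by (simp add: routing_policy_def)
  \<comment> \<open>The weights in \<open>pot\<close> make each useful move a decrease: a full car
    weighs more than the idle car it becomes, so does a travelling empty car, and an idle car
    outside \<open>k\<close> weighs more than a full car bound for \<open>k\<close>.\<close>
  have step: "\<exists>y\<in>?S. 0 < ?R x y \<and> pot y < pot x" if x: "x \<in> ?S" "pot x \<noteq> 0" for x
  proof -
    obtain E F where EF: "x = (E, F)" by force
    with x(1) have xS: "(E, F) \<in> ?S" by simp
    note rate_ge = rate_ge[of lam mu, OF pos P(1) Q N xS]
    have potE: "pot (E, F') = pot (dec E i j, F') + (if i = j then if i = k then 0 else 2 else 3)"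
      if "0 < E i j" for i j F'
      unfolding pot_def by (subst inc_dec[of E i j, OF that, symmetric]) simp
    have potF: "pot (E', F) = pot (E', dec F i j) + (if j = k then 1 else 3)"
      if "0 < F i j" for i j E'
      unfolding pot_def by (subst inc_dec[of F i j, OF that, symmetric]) simp
    have pot_inc: "pot (inc E' i i, F') \<le> pot (E', F') + 2" "pot (inc E' k k, F') = pot (E', F')"
      "pot (E', inc F' i k) = pot (E', F') + 1" for E' F' i
      by (simp_all add: pot_def)
    consider i j where "0 < F i j" | i j where "0 < E i j" "i \<noteq> j" | i where "0 < E i i" "i \<noteq> k"
    proof -
      have "\<exists>i j. 0 < F i j \<or> (0 < E i j \<and> (i \<noteq> j \<or> i \<noteq> k))"
      proof (rule ccontr)
        assume "\<not> ?thesis"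
        then have F0: "F i j = 0" and E0: "i \<noteq> j \<or> i \<noteq> k \<Longrightarrow> E i j = 0" for i j by auto
        have "pot (E, F) = 0"
          unfolding pot_def linear_obs_def by (auto simp: F0 E0 intro!: sum.neutral)
        with x(2) EF show False by simp
      qed
      then show thesis using that by blast
    qed
    then show ?thesis
    proof cases
      case (1 i j)
      have "0 < mu i j * real (F i j) * q j j"
        using 1 pos(2) q(2) by simp
      then have "0 < ?R (E, F) (inc E j j, dec F i j)"
        using rate_ge(2)[of i j j] by simp
      moreover have "pot (inc E j j, dec F i j) < pot (E, F)"
        using potF[OF 1, of E] pot_inc(1)[of E j "dec F i j"] pot_inc(2)[of E "dec F i j"] by (cases "j = k") auto
      ultimately show ?thesis
        using move_mem_states(3)[OF xS 1] EF by blast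
    next
      case (2 i j)
      have "0 < mu i j * real (E i j)"
        using 2 pos(2) by simp
      then have "0 < ?R (E, F) (inc (dec E i j) j j, F)"
        using rate_ge(3)[OF 2(2)] by simp
      moreover have "pot (inc (dec E i j) j j, F) < pot (E, F)"
        using potE[OF 2(1), of F] pot_inc(1)[of "dec E i j" j F] 2(2) by simp
      ultimately show ?thesis
        using move_mem_states(2)[OF xS 2(1)] EF by blast
    next
      case (3 i)
      have "0 < real N * lam i * P i k"
        using N pos(1) P(2) by simp
      then have "0 < ?R (E, F) (dec E i i, inc F i k)"
        using rate_ge(1)[OF 3(1), of k] by simp
      moreover have "pot (dec E i i, inc F i k) < pot (E, F)"
        using potE[OF 3(1), of F] pot_inc(3)[of "dec E i i" F i] 3(2) by simp
      ultimately show ?thesis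
        using move_mem_states(1)[OF xS 3(1)] EF by blast
    qed
  qed
  have pot0: "x = c" if x: "x \<in> ?S" "pot x = 0" for x
  proof -
    obtain E F where EF: "x = (E, F)" by force
    have F0: "F i j = 0" for i j
      using x(2) by (auto simp: EF pot_def linear_obs_def split: if_splits)
    have E0: "E i j = 0" if "\<not> (i = k \<and> j = k)" for i j
    proof -
      have "(if i = j then if i = k then 0 else 2 else 3 :: nat) * E i j = 0"
        using x(2) unfolding EF pot_def linear_obs_def by (simp del: mult_eq_0_iff)
      with that show ?thesis by (auto split: if_splits)
    qed
    have "N = (\<Sum>i\<in>UNIV. \<Sum>j\<in>UNIV. if i = k then if j = k then E k k else 0 else 0)"
      using x(1) unfolding EF states_def by (auto simp: F0 E0 intro!: sum.cong)
    also have "\<dots> = (\<Sum>i\<in>UNIV. if i = k then E k k else 0)"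
      by (intro sum.cong) (auto simp: sum.delta)
    finally have "N = E k k" by (simp add: sum.delta)
    then show ?thesis
      using F0 E0 by (auto simp: EF c_def fun_eq_iff)
  qed
  have acc: "accessible ?S ?R x c" if "x \<in> ?S" for x
    using that
  proof (induction "pot x" arbitrary: x rule: less_induct)
    case less
    show ?case
    proof (cases "pot x = 0")
      case True
      then show ?thesis
        using pot0[OF less.prems] accessible_refl by simp
    next
      case False
      then obtain y where y: "y \<in> ?S" "0 < ?R x y" "pot y < pot x"
        using step[OF less.prems] by blast
      then have "accessible ?S ?R x y"
        using less.prems unfolding accessible_def by (intro r_into_rtranclp) simp
      then show ?thesis
        using less.hyps[OF y(3) y(1)] by (rule accessible_trans)
    qed
  qed
  have "(\<Sum>i\<in>UNIV. \<Sum>j\<in>UNIV. if i = k \<and> j = k then N else 0) =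
      (\<Sum>i\<in>UNIV. if i = k then N else 0)"
    by (intro sum.cong) (auto simp: sum.delta)
  then have "c \<in> ?S"
    by (simp add: c_def states_def sum.delta)
  with acc show ?thesis by blast
qed

text \<open>Customers arrive at rates \<open>N * lam i\<close>, so \<open>N\<close> times the fluid
  solution solves the traffic equations of \<open>weight_invariant\<close> and the law is explicit.
  It is returned as \<pi> so that \<open>availability_less\<close> can be applied to it.\<close>

lemma availability_static:
  fixes lam :: "'r::finite \<Rightarrow> real" and N :: nat
  assumes pos: "\<And>i. lam i > 0" "\<And>i j. mu i j > 0" and P: "row_stochastic P" "\<And>i j. P i j > 0"
    and q: "\<And>i. q i i > 0" and feas: "fluid_feasible lam mu P q e f a" and N: "N > 0"
  obtains \<alpha> \<pi> where
    "stationary_dist (states N) (rate lam mu P (\<lambda>_. q) N) = \<pi>"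
    "is_stationary (states N) (rate lam mu P (\<lambda>_. q) N) \<pi>"
    "availability lam mu P (\<lambda>_. q) N = (\<lambda>i. \<alpha> * a i)"
    "real N / (real N + (real CARD('r) + sqrt (real CARD('r) * real N))) \<le> \<alpha>"
proof -
  have feasible: "lam i * P i j * a i = mu i j * f i j"
    "i \<noteq> j \<Longrightarrow> mu i j * e i j = q i j * (\<Sum>k\<in>UNIV. mu k i * f k i)"
    "lam i * a i = (\<Sum>k\<in>UNIV - {i}. mu k i * e k i) + q i i * (\<Sum>k\<in>UNIV. mu k i * f k i)"
    "(1 - a i) * e i i = 0" "(e, f) \<in> fluid_space" "row_stochastic q" "0 \<le> a i" "a i \<le> 1" for i j
    using feas unfolding fluid_feasible_def by blast+
  have nonneg: "0 \<le> e i j" "0 \<le> f i j" for i j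
    using feasible(5) by (auto simp: fluid_space_def)
  have mass: "(\<Sum>i\<in>UNIV. \<Sum>j\<in>UNIV. e i j + f i j) = 1"
    using feasible(5) by (auto simp: fluid_space_def)
  obtain M where M: "N = Suc M"
    using N by (cases N) auto
  \<comment> \<open>These loads depend on \<open>N\<close> and stay fixed while the number of cars
    \<open>M\<close> in \<open>g M\<close> varies; this is what makes an induction on
    \<open>M\<close> possible.\<close>
  define y where "y i j = real N * e i j" for i j
  define z where "z i j = real N * f i j" for i j
  define w where "w = weight a y z"
  define g where "g = partition_sum a y z"
  define m where "m = (\<Sum>i\<in>UNIV. \<Sum>j\<in>UNIV - {i}. e i j) + (\<Sum>i\<in>UNIV. \<Sum>j\<in>UNIV. f i j)"
  have m: "m + (\<Sum>i\<in>UNIV. e i i) = 1"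
    using mass sum_off_diagonal[of e] by (simp add: m_def sum.distrib)
  have diag: "0 \<le> (\<Sum>i\<in>UNIV. e i i)"
    using nonneg by (intro sum_nonneg)
  have m_nonneg: "0 \<le> m"
    unfolding m_def using nonneg by (intro add_nonneg_nonneg sum_nonneg)
  have yz: "(\<Sum>i\<in>UNIV. \<Sum>j\<in>UNIV - {i}. y i j) + (\<Sum>i\<in>UNIV. \<Sum>j\<in>UNIV. z i j) = real N * m"
    by (simp add: y_def z_def m_def distrib_left sum_distrib_left)
  have yz_nonneg: "0 \<le> y i j" "0 \<le> z i j" for i j
    using nonneg by (simp_all add: y_def z_def)
  \<comment> \<open>If nothing moves, some mass is parked, and complementarity gives that region
    availability 1; so some load is positive.\<close>
  have "0 < real N * m + (\<Sum>i\<in>UNIV. a i)"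
  proof (cases "m = 0")
    case True
    with m have "(\<Sum>i\<in>UNIV. e i i) \<noteq> 0" by simp
    then obtain i where "e i i \<noteq> 0" by (meson sum.neutral)
    then have "a i = 1" using feasible(4)[of i] by simp
    then have "0 < (\<Sum>i\<in>UNIV. a i)"
      using feasible(7) by (intro sum_pos2[of UNIV i]) auto
    with True show ?thesis by simp
  next
    case False
    then show ?thesis
      using m_nonneg N feasible(7) by (intro add_pos_nonneg sum_nonneg) auto
  qed
  then have g_pos: "0 < g M" for M
    unfolding g_def by (intro partition_sum_pos feasible(7) yz_nonneg) (simp add: yz)
  have w_nonneg: "0 \<le> w x" for x
    unfolding w_def by (intro weight_nonneg feasible(7) yz_nonneg)
  have sum_z: "(\<Sum>k\<in>UNIV. mu k i * z k i) = real N * (\<Sum>k\<in>UNIV. mu k i * f k i)" for i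
    by (simp add: z_def sum_distrib_left mult_ac)
  have sum_y: "(\<Sum>k\<in>UNIV - {i}. mu k i * y k i) = real N * (\<Sum>k\<in>UNIV - {i}. mu k i * e k i)" for i
    by (simp add: y_def sum_distrib_left mult_ac)
  have inv: "invariant (states N) (rate lam mu P (\<lambda>_. q) N) w"
    unfolding w_def
  proof (rule weight_invariant[OF N P(1) feasible(6)])
    show "real N * lam i * P i j * a i = mu i j * z i j" for i j
      using feasible(1)[of i j] by (simp add: z_def mult.assoc)
    show "mu i j * y i j = q i j * (\<Sum>k\<in>UNIV. mu k i * z k i)" if "i \<noteq> j" for i j
      unfolding sum_z using feasible(2)[OF that] by (simp add: y_def)
    show "real N * lam i * a i =
        (\<Sum>k\<in>UNIV - {i}. mu k i * y k i) + q i i * (\<Sum>k\<in>UNIV. mu k i * z k i)" for i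
      unfolding sum_z sum_y using arg_cong[OF feasible(3)[of i], of "(*) (real N)"]
      by (simp add: distrib_left mult_ac)
  qed
  have gN: "(\<Sum>x\<in>states N. w x) = g N"
    by (simp add: g_def w_def partition_sum_def)
  obtain \<pi> where \<pi>: "is_stationary (states N) (rate lam mu P (\<lambda>_. q) N) \<pi>"
    "\<And>x. x \<in> states N \<Longrightarrow> pmf \<pi> x = w x / g N"
    using normalized_invariant_stationary[OF finite_states w_nonneg _ inv] g_pos[of N]
    unfolding gN by blast
  have Q: "routing_policy (\<lambda>_. q)"
    using feasible(6) by (simp add: routing_policy_def)
  obtain c where "\<And>x. x \<in> states N \<Longrightarrow> accessible (states N) (rate lam mu P (\<lambda>_. q) N) x c"
    using static_hub[of lam mu P q, OF pos P feasible(6) q N] by blast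
  then have st: "stationary_dist (states N) (rate lam mu P (\<lambda>_. q) N) = \<pi>"
    using stationary_dist_eq[OF finite_states rate_nonneg[OF pos P(1) Q N] _ \<pi>(1)] by blast
  have sub: "set_pmf \<pi> \<subseteq> states N"
    using \<pi>(1) by (simp add: is_stationary_def)
  \<comment> \<open>Removing an idle car at \<open>i\<close> costs the factor \<open>a i\<close> and
    leaves the full sum over \<open>N - 1\<close> cars, hence one \<alpha> for all regions.\<close>
  define \<alpha> where "\<alpha> = g M / g N"
  have "availability lam mu P (\<lambda>_. q) N i = \<alpha> * a i" for i
  proof -
    have "availability lam mu P (\<lambda>_. q) N i =
        (\<Sum>x\<in>states (Suc M). w x * (if 0 < fst x i i then 1 else 0)) / g N"
      unfolding availability_eq_mean[OF st sub N] mean_def sum_divide_distrib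
      by (intro sum.cong) (auto simp: M[symmetric] \<pi>(2))
    also have "\<dots> = \<alpha> * a i"
      unfolding w_def sum_weight_diag
      by (simp add: \<alpha>_def g_def partition_sum_def flip: sum_distrib_right)
    finally show ?thesis .
  qed
  then have avail: "availability lam mu P (\<lambda>_. q) N = (\<lambda>i. \<alpha> * a i)" ..
  define r where "r = real CARD('r)"
  \<comment> \<open>D^2 exceeds r (N + D) by r sqrt (r N), while D / N still tends to 0.\<close>
  define D where "D = r + sqrt (r * real N)"
  have r: "0 < r" by (simp add: r_def)
  have sqrt: "0 \<le> sqrt (r * real N)" "sqrt (r * real N) * sqrt (r * real N) = r * real N"
    using r by simp_all
  have "real (Suc M) * g (Suc M) \<le> (real N + D) * g M"
  proof (rule partition_ratio_bound)
    show "real (Suc K) * g (Suc K) = real N * m * g K + idle_sum a y z (Suc K)" for K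
      unfolding g_def partition_sum_Suc yz ..
    show "idle_sum a y z (Suc K) \<le> r * g K + idle_sum a y z K" for K
      unfolding g_def r_def by (intro idle_sum_Suc_le feasible(7,8) yz_nonneg)
    show "idle_sum a y z 0 = 0"
      by (simp add: idle_sum_def states_0)
    show "real N * m \<le> real N"
      using m diag N by (intro mult_left_le) auto
    show "0 < D"
      unfolding D_def using r sqrt(1) by (rule add_pos_nonneg)
    show "r * (real N + D) \<le> D * D"
      using r sqrt by (simp add: D_def algebra_simps)
  qed (use m_nonneg r g_pos M in auto)
  moreover have "0 < D"
    unfolding D_def using r sqrt(1) by (rule add_pos_nonneg)
  ultimately have "real N / (real N + D) \<le> \<alpha>"
    using g_pos[of N] by (simp add: \<alpha>_def M field_simps)
  then show thesis
    using that[OF st \<pi>(1) avail] by (simp add: D_def r_def)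
qed

theorem theorem2:
  fixes lam :: "'r::finite \<Rightarrow> real"
    and mu c P q e f :: "'r \<Rightarrow> 'r \<Rightarrow> real"
    and a :: "'r \<Rightarrow> real"
  assumes "\<And>i. lam i > 0"
    and "\<And>i j. mu i j > 0"
    and "\<And>i j. c i j > 0"
    and "row_stochastic P"
    and "fluid_optimal lam mu c P q e f a"
  shows "(\<forall>Q N. routing_policy Q \<longrightarrow> N > 0 \<longrightarrow>
            single_recurrent_class (states N) (rate lam mu P Q N) \<longrightarrow>
            reward lam P c (availability lam mu P Q N) < reward lam P c a) \<and>
         ((\<forall>i j. P i j > 0) \<longrightarrow> (\<forall>i. q i i > 0) \<longrightarrow>
            (\<lambda>N. reward lam P c (availability lam mu P (\<lambda>_. q) N)) \<longlonglongrightarrow> reward lam P c a)"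
proof -
  have feas: "fluid_feasible lam mu P q e f a"
    using assms(5) by (simp add: fluid_optimal_def)
  have less: "reward lam P c (availability lam mu P Q N) < reward lam P c a"
    if Q: "routing_policy Q" and N: "N > 0"
      and single: "single_recurrent_class (states N) (rate lam mu P Q N)" for Q N
  proof -
    let ?S = "states N :: 'r state set" and ?R = "rate lam mu P Q N"
    have nn: "0 \<le> ?R x y" if "x \<in> ?S" for x y
      by (rule rate_nonneg[OF assms(1,2,4) Q N that])
    \<comment> \<open>The state \<open>h\<close> gives uniqueness and shows that the state space is
      nonempty, as the existence of an invariant measure requires; together they identify
      \<open>stationary_dist\<close>.\<close>
    obtain h where h: "h \<in> ?S" "\<forall>x\<in>?S. accessible ?S ?R x h"
      using single_recurrent_class_imp_hub[OF finite_states single] by (elim bexE) (rule that)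
    have "\<exists>p. (\<forall>x\<in>?S. 0 \<le> p x) \<and> (\<exists>x\<in>?S. 0 < p x) \<and> invariant ?S ?R p"
      using h(1) nn by (intro invariant_exists finite_states) auto
    then obtain p x where p: "\<And>x. x \<in> ?S \<Longrightarrow> 0 \<le> p x" "invariant ?S ?R p"
      and x: "x \<in> ?S" "0 < p x"
      by auto
    have "0 < (\<Sum>x\<in>?S. p x)"
      using finite_states x p(1) by (rule sum_pos2)
    then obtain \<pi> where \<pi>: "is_stationary ?S ?R \<pi>"
      using normalized_invariant_stationary[OF finite_states p(1) _ p(2)] by blast
    have "stationary_dist ?S ?R = \<pi>"
      by (rule stationary_dist_eq[OF finite_states nn bspec[OF h(2)] \<pi>])
    then show ?thesis
      using availability_less[OF assms Q N _ \<pi>] by blast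
  qed
  moreover have "(\<lambda>N. reward lam P c (availability lam mu P (\<lambda>_. q) N)) \<longlonglongrightarrow> reward lam P c a"
    if P: "\<And>i j. P i j > 0" and q: "\<And>i. q i i > 0"
  proof (rule tendsto_sandwich)
    define r where "r = real CARD('r)"
    define l where "l N = real N / (real N + (r + sqrt (r * real N)))" for N
    have Q: "routing_policy (\<lambda>_. q)"
      using feas by (simp add: fluid_feasible_def routing_policy_def)
    have "0 \<le> reward lam P c a"
      unfolding reward_def using assms(1,3) P feas
      by (intro sum_nonneg mult_nonneg_nonneg) (auto simp: fluid_feasible_def less_imp_le)
    have bounds: "l N * reward lam P c a \<le> reward lam P c (availability lam mu P (\<lambda>_. q) N) \<and>
        reward lam P c (availability lam mu P (\<lambda>_. q) N) \<le> reward lam P c a" if N: "N > 0" for N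
    proof -
      obtain \<alpha> \<pi> where st: "stationary_dist (states N) (rate lam mu P (\<lambda>_. q) N) = \<pi>"
        "is_stationary (states N) (rate lam mu P (\<lambda>_. q) N) \<pi>"
        and avail: "availability lam mu P (\<lambda>_. q) N = (\<lambda>i. \<alpha> * a i)" and \<alpha>: "l N \<le> \<alpha>"
        using availability_static[OF assms(1,2,4) P q feas N] unfolding l_def r_def by blast
      \<comment> \<open>The common factor \<alpha> can be pulled out of the reward, so its lower
        bound carries over.\<close>
      have "l N * reward lam P c a \<le> \<alpha> * reward lam P c a"
        using \<alpha> \<open>0 \<le> reward lam P c a\<close> by (rule mult_right_mono)
      then show ?thesis
        using availability_less[OF assms Q N st] by (simp add: avail reward_scale)
    qed
    show "\<forall>\<^sub>F N in sequentially. l N * reward lam P c a \<le> reward lam P c (availability lam mu P (\<lambda>_. q) N)"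
      "\<forall>\<^sub>F N in sequentially. reward lam P c (availability lam mu P (\<lambda>_. q) N) \<le> reward lam P c a"
      using bounds by (auto intro: eventually_mono[OF eventually_gt_at_top[of 0]])
    have "0 < r" by (simp add: r_def)
    then have "l \<longlonglongrightarrow> 1"
      unfolding l_def by real_asymp
    then show "(\<lambda>N. l N * reward lam P c a) \<longlonglongrightarrow> reward lam P c a"
      using tendsto_mult_right[of l 1 sequentially "reward lam P c a"] by simp
  qed simp
  ultimately show ?thesis by blast
qed

end
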